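(* Let $\ell$ be a non-negative integer. Let $V(-\ell)$ be the unique irreducible representation of $\mathfrak{osp}(1|2)$ of dimension $2\ell+1$, with highest weight vector $v_\ell$, and let $\mathbb{C}[x]=V(\tfrac12)$ be the polynomial representation of $\mathfrak{osp}(1|2)$ with highest weight vector $1$. Then we have the following explicit decomposition into irreducible $\mathfrak{osp}(1|2)$-representations: $$\mathbb{C}[x]\otimes V(-\ell)=\bigoplus_{j=0}^{2\ell}U(\mathfrak n_-)\Big(\tilde x_{-\alpha}-\frac{1}{H-1}X_{-\alpha}\tilde h-\frac{1}{H-1}X_{-\alpha}^2\tilde x_\alpha-\frac{2}{(H-2)(H-1)}X_{-\alpha}^3\tilde x_{2\alpha}\Big)^{j}(1\otimes v_\ell),$$ where $X_{-\alpha}=x_{-\alpha}\otimes1+1\otimes x_{-\alpha}$, $\tilde x_\beta=x_\beta\otimes1-1\otimes x_\beta$ for $\beta\in\{\pm\alpha,\pm2\alpha\}$, $H=h\otimes1+1\otimes h$ and $\tilde h=h\otimes1-1\otimes h$.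
   Context: The ground field is $\mathbb{C}$. $\mathfrak{osp}(1|2)$ has basis $x_{-2\alpha},x_{-\alpha},h,x_\alpha,x_{2\alpha}$ ($x_{\pm\alpha}$ odd, the others even) with supercommutators $[h,x_{\pm k\alpha}]=\mp k\,x_{\pm k\alpha}$ and $[x_{-k\alpha},x_{k\alpha}]=h$ for $k\in\{1,2\}$, $[x_{\pm\alpha},x_{\pm\alpha}]=\mp 2x_{\pm2\alpha}$, $[x_{\pm\alpha},x_{\mp2\alpha}]=x_{\mp\alpha}$, $[x_{\pm2\alpha},x_{\pm\alpha}]=0$. The positive root $\alpha\in(\mathbb{C}h)^*$ satisfies $\alpha(h)=-1$. Triangular decomposition: $\mathfrak{osp}(1|2)=\mathfrak n_-\oplus\mathbb{C}h\oplus\mathfrak n_+$ with $\mathfrak n_\pm=\mathbb{C}x_{\pm2\alpha}\oplus\mathbb{C}x_{\pm\alpha}$. $V(\xi)$ denotes the irreducible highest weight representation with highest weight vector $v$ satisfying $h.v=\xi v$, $x_\alpha.v=x_{2\alpha}.v=0$. In particular $h.v_\ell=-\ell v_\ell$. The polynomial representation $\mathbb{C}[x]=V(\tfrac12)$ is the one where $x_\alpha$ acts by a scalar multiple of $d/dx$, $x_{-\alpha}$ by a scalar multiple of multiplication by $x$ (the product of the two scalars being $\tfrac12$), $h$ by $x\frac{d}{dx}+\tfrac12$, and parity is given by degree mod $2$. On the tensor product, $a\otimes b$ acts with the usual super sign rule, $(a\otimes b)(u\otimes v)=(-1)^{|b||u|}au\otimes bv$, and $\mathfrak{osp}(1|2)$,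 hence $U(\mathfrak n_-)$, acts diagonally by $x\mapsto x\otimes1+1\otimes x$. The operators $H-1$ and $H-2$ act invertibly on $\mathbb{C}[x]\otimes V(-\ell)$, since all $H$-weights lie in $\tfrac12+\mathbb{Z}$. *)

theory Defs
  imports "HOL-Analysis.Analysis" "HOL-Computational_Algebra.Polynomial"
    "HOL-Library.Poly_Mapping" "HOL-Library.Z2"
begin

section \<open>Complex vector spaces\<close>

class cvector = ab_group_add +
  fixes scaleC :: "complex \<Rightarrow> 'a \<Rightarrow> 'a"  (infixr \<open>*\<^sub>C\<close> 75)
  assumes scaleC_add_right: "c *\<^sub>C (x + y) = c *\<^sub>C x + c *\<^sub>C y"
    and scaleC_add_left: "(c + d) *\<^sub>C x = c *\<^sub>C x + d *\<^sub>C x"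
    and scaleC_scaleC: "c *\<^sub>C (d *\<^sub>C x) = (c * d) *\<^sub>C x"
    and scaleC_one: "1 *\<^sub>C x = x"

global_interpretation cv: vector_space "scaleC :: complex \<Rightarrow> 'a \<Rightarrow> 'a::cvector"
  by unfold_locales (rule scaleC_add_right scaleC_add_left scaleC_scaleC scaleC_one)+

abbreviation clinear :: "('a::cvector \<Rightarrow> 'b::cvector) \<Rightarrow> bool"
  where "clinear \<equiv> Vector_Spaces.linear scaleC scaleC"

definition cbilinear :: "('a::cvector \<Rightarrow> 'b::cvector \<Rightarrow> 'c::cvector) \<Rightarrow> bool"
  where "cbilinear f \<longleftrightarrow> (\<forall>v. clinear (\<lambda>u. f u v)) \<and> (\<forall>u. clinear (f u))"

lemma clinearI:
  assumes "\<And>x y. f (x + y) = f x + f y" "\<And>c x. f (c *\<^sub>C x) = c *\<^sub>C f x"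
  shows "clinear f"
  using assms by unfold_locales auto

lemma clinear_add: "clinear f \<Longrightarrow> f (x + y) = f x + f y"
  and clinear_scale: "clinear f \<Longrightarrow> f (c *\<^sub>C x) = c *\<^sub>C f x"
  by (simp_all add: Vector_Spaces.linear_iff)

text \<open>An internal direct sum of a finite family of subspaces, filling the whole space.\<close>

definition is_direct_sum :: "'i set \<Rightarrow> ('i \<Rightarrow> 'a::cvector set) \<Rightarrow> bool"
  where "is_direct_sum I W \<longleftrightarrow>
    finite I \<and> (\<forall>i\<in>I. cv.subspace (W i)) \<and>
    (\<forall>w. \<exists>!f. (\<forall>i\<in>I. f i \<in> W i) \<and> (\<forall>i. i \<notin> I \<longrightarrow> f i = 0) \<and> w = (\<Sum>i\<in>I. f i))"


section \<open>Tensor products\<close>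

text \<open>The free vector space on \<open>'a \<times> 'b\<close>, modulo the bilinearity relations.\<close>

instantiation poly_mapping :: (type, cvector) cvector
begin

lift_definition scaleC_poly_mapping :: "complex \<Rightarrow> ('a \<Rightarrow>\<^sub>0 'b) \<Rightarrow> ('a \<Rightarrow>\<^sub>0 'b)"
  is "\<lambda>c f k. c *\<^sub>C f k"
  by (erule rev_finite_subset) auto

instance
  by standard (transfer; simp add: fun_eq_iff scaleC_add_right scaleC_add_left scaleC_scaleC scaleC_one)+

end

instantiation complex :: cvector
begin

definition scaleC_complex :: "complex \<Rightarrow> complex \<Rightarrow> complex"
  where "scaleC_complex = (*)"

instance
  by standard (simp_all add: scaleC_complex_def algebra_simps)

end

definition tensor_relators :: "('a::cvector \<times> 'b::cvector \<Rightarrow>\<^sub>0 complex) set"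
  where "tensor_relators =
      {Poly_Mapping.single (u + u', v) 1 -
        (Poly_Mapping.single (u, v) 1 + Poly_Mapping.single (u', v) 1) | u u' v. True}
    \<union> {Poly_Mapping.single (u, v + v') 1 -
        (Poly_Mapping.single (u, v) 1 + Poly_Mapping.single (u, v') 1) | u v v'. True}
    \<union> {Poly_Mapping.single (c *\<^sub>C u, v) 1 - c *\<^sub>C Poly_Mapping.single (u, v) 1 | c u v. True}
    \<union> {Poly_Mapping.single (u, c *\<^sub>C v) 1 - c *\<^sub>C Poly_Mapping.single (u, v) 1 | c u v. True}"

definition tensor_rel ::
    "('a::cvector \<times> 'b::cvector \<Rightarrow>\<^sub>0 complex) \<Rightarrow> ('a \<times> 'b \<Rightarrow>\<^sub>0 complex) \<Rightarrow> bool"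
  where "tensor_rel f g \<longleftrightarrow> f - g \<in> cv.span tensor_relators"

quotient_type (overloaded) ('a, 'b) tensor = "'a::cvector \<times> 'b::cvector \<Rightarrow>\<^sub>0 complex" / tensor_rel
proof (rule equivpI)
  show "reflp (tensor_rel :: ('a \<times> 'b \<Rightarrow>\<^sub>0 complex) \<Rightarrow> _)"
    by (rule reflpI) (simp add: tensor_rel_def cv.span_zero)
  show "symp (tensor_rel :: ('a \<times> 'b \<Rightarrow>\<^sub>0 complex) \<Rightarrow> _)"
    by (rule sympI) (metis tensor_rel_def cv.span_neg minus_diff_eq)
  show "transp (tensor_rel :: ('a \<times> 'b \<Rightarrow>\<^sub>0 complex) \<Rightarrow> _)"
  proof (rule transpI)
    fix f g h :: "'a \<times> 'b \<Rightarrow>\<^sub>0 complex"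
    assume "tensor_rel f g" "tensor_rel g h"
    then have "(f - g) + (g - h) \<in> cv.span tensor_relators"
      unfolding tensor_rel_def by (rule cv.span_add)
    then show "tensor_rel f h" by (simp add: tensor_rel_def)
  qed
qed

instantiation tensor :: (cvector, cvector) cvector
begin

lift_definition zero_tensor :: "('a, 'b) tensor" is 0 .

lift_definition plus_tensor :: "('a, 'b) tensor \<Rightarrow> ('a, 'b) tensor \<Rightarrow> ('a, 'b) tensor"
  is "(+)"
  unfolding tensor_rel_def by (metis add_diff_add cv.span_add)

lift_definition uminus_tensor :: "('a, 'b) tensor \<Rightarrow> ('a, 'b) tensor"
  is "uminus"
  unfolding tensor_rel_def by (metis minus_diff_minus cv.span_neg)

lift_definition minus_tensor :: "('a, 'b) tensor \<Rightarrow> ('a, 'b) tensor \<Rightarrow> ('a, 'b) tensor"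
  is "(-)"
proof -
  fix f f' g g' :: "'a \<times> 'b \<Rightarrow>\<^sub>0 complex"
  assume "tensor_rel f f'" "tensor_rel g g'"
  then have "(f - f') - (g - g') \<in> cv.span tensor_relators"
    unfolding tensor_rel_def by (rule cv.span_diff)
  then show "tensor_rel (f - g) (f' - g')"
    by (simp add: tensor_rel_def algebra_simps)
qed

lift_definition scaleC_tensor :: "complex \<Rightarrow> ('a, 'b) tensor \<Rightarrow> ('a, 'b) tensor"
  is "scaleC"
  unfolding tensor_rel_def by (metis cv.scale_right_diff_distrib cv.span_scale)

instance
  by standard (transfer; simp add: tensor_rel_def cv.span_zero algebra_simps
      scaleC_add_right scaleC_add_left scaleC_scaleC scaleC_one)+

end

lift_definition tensor_prod :: "'a::cvector \<Rightarrow> 'b::cvector \<Rightarrow> ('a, 'b) tensor"  (infixl \<open>\<otimes>\<close> 70)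
  is "\<lambda>u v. Poly_Mapping.single (u, v) 1" .

lemma cbilinear_tensor_prod: "cbilinear (\<otimes>)"
  unfolding cbilinear_def
proof (intro conjI allI clinearI; transfer)
  fix u u' :: "'a" and v v' :: "'b" and c
  show "tensor_rel (Poly_Mapping.single (u + u', v) 1)
      (Poly_Mapping.single (u, v) 1 + Poly_Mapping.single (u', v) 1)"
    unfolding tensor_rel_def by (rule cv.span_base, unfold tensor_relators_def) blast
  show "tensor_rel (Poly_Mapping.single (u, v + v') 1)
      (Poly_Mapping.single (u, v) 1 + Poly_Mapping.single (u, v') 1)"
    unfolding tensor_rel_def by (rule cv.span_base, unfold tensor_relators_def) blast
  show "tensor_rel (Poly_Mapping.single (c *\<^sub>C u, v) 1) (c *\<^sub>C Poly_Mapping.single (u, v) 1)"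
    unfolding tensor_rel_def by (rule cv.span_base, unfold tensor_relators_def) blast
  show "tensor_rel (Poly_Mapping.single (u, c *\<^sub>C v) 1) (c *\<^sub>C Poly_Mapping.single (u, v) 1)"
    unfolding tensor_rel_def by (rule cv.span_base, unfold tensor_relators_def) blast
qed

lemmas tensor_prod_add_left = cbilinear_tensor_prod[unfolded cbilinear_def, THEN conjunct1, rule_format, THEN clinear_add]
  and tensor_prod_add_right = cbilinear_tensor_prod[unfolded cbilinear_def, THEN conjunct2, rule_format, THEN clinear_add]
  and tensor_prod_scale_left = cbilinear_tensor_prod[unfolded cbilinear_def, THEN conjunct1, rule_format, THEN clinear_scale]
  and tensor_prod_scale_right = cbilinear_tensor_prod[unfolded cbilinear_def, THEN conjunct2, rule_format, THEN clinear_scale]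

definition free_lift :: "('a \<Rightarrow> 'b \<Rightarrow> 'c::cvector) \<Rightarrow> ('a \<times> 'b \<Rightarrow>\<^sub>0 complex) \<Rightarrow> 'c"
  where "free_lift f g = (\<Sum>(u, v)\<in>Poly_Mapping.keys g. Poly_Mapping.lookup g (u, v) *\<^sub>C f u v)"

text \<open>The linear map induced by a bilinear map; see \<open>tensor_lift_prod\<close> and
  \<open>clinear_tensor_lift\<close> below.\<close>

definition tensor_lift :: "('a::cvector \<Rightarrow> 'b::cvector \<Rightarrow> 'c::cvector) \<Rightarrow> ('a, 'b) tensor \<Rightarrow> 'c"
  where "tensor_lift f t = free_lift f (rep_tensor t)"

lemma free_lift_superset:
  assumes "finite S" "Poly_Mapping.keys g \<subseteq> S"
  shows "free_lift f g = (\<Sum>(u, v)\<in>S. Poly_Mapping.lookup g (u, v) *\<^sub>C f u v)"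
  unfolding free_lift_def
  by (rule sum.mono_neutral_left) (use assms in \<open>auto simp: in_keys_iff\<close>)

lemma clinear_free_lift: "clinear (free_lift f)"
proof (rule clinearI)
  fix g h :: "'a \<times> 'b \<Rightarrow>\<^sub>0 complex" and c
  let ?S = "Poly_Mapping.keys g \<union> Poly_Mapping.keys h"
  have "free_lift f (g + h) = (\<Sum>(u, v)\<in>?S. Poly_Mapping.lookup (g + h) (u, v) *\<^sub>C f u v)"
    by (rule free_lift_superset) (simp_all add: Poly_Mapping.keys_add)
  also have "\<dots> = (\<Sum>(u, v)\<in>?S. Poly_Mapping.lookup g (u, v) *\<^sub>C f u v)
      + (\<Sum>(u, v)\<in>?S. Poly_Mapping.lookup h (u, v) *\<^sub>C f u v)"
    by (simp add: lookup_add scaleC_add_left case_prod_beta sum.distrib)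
  also have "\<dots> = free_lift f g + free_lift f h"
    by (simp add: free_lift_superset[of ?S])
  finally show "free_lift f (g + h) = free_lift f g + free_lift f h" .
  have l: "Poly_Mapping.lookup (c *\<^sub>C g) k = c * Poly_Mapping.lookup g k" for k
    by (simp add: scaleC_poly_mapping.rep_eq scaleC_complex_def)
  have "free_lift f (c *\<^sub>C g)
      = (\<Sum>(u, v)\<in>Poly_Mapping.keys g. Poly_Mapping.lookup (c *\<^sub>C g) (u, v) *\<^sub>C f u v)"
    by (rule free_lift_superset) (auto simp: in_keys_iff l)
  then show "free_lift f (c *\<^sub>C g) = c *\<^sub>C free_lift f g"
    by (simp add: l free_lift_def cv.scale_sum_right case_prod_beta scaleC_scaleC)
qed

lemma free_lift_single: "free_lift f (Poly_Mapping.single (u, v) 1) = f u v"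
  by (simp add: free_lift_def scaleC_one)

lemma free_lift_relator:
  assumes f: "cbilinear f" and g: "g \<in> cv.span tensor_relators"
  shows "free_lift f g = 0"
proof -
  interpret L: Vector_Spaces.linear scaleC scaleC "free_lift f" by (rule clinear_free_lift)
  have f': "f (u + u') v = f u v + f u' v" "f u (v + v') = f u v + f u v'"
    "f (c *\<^sub>C u) v = c *\<^sub>C f u v" "f u (c *\<^sub>C v) = c *\<^sub>C f u v" for u u' v v' c
    using f by (simp_all add: cbilinear_def Vector_Spaces.linear_iff)
  from g show ?thesis
  proof (induction rule: cv.span_induct_alt)
    case base
    show ?case by (rule L.zero)
  next
    case (step c x y)
    from step(1) have "free_lift f x = 0"
      by (auto simp: tensor_relators_def L.diff L.add L.scale free_lift_single f')
    with step(2) show ?case by (simp add: L.add L.scale)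
  qed
qed

lemma tensor_lift_abs:
  assumes "cbilinear f"
  shows "tensor_lift f (abs_tensor g) = free_lift f g"
proof -
  interpret L: Vector_Spaces.linear scaleC scaleC "free_lift f" by (rule clinear_free_lift)
  have "tensor_rel (rep_tensor (abs_tensor g)) g"
    using Quotient3_rep_abs[OF Quotient3_tensor] by (simp add: equivp_reflp[OF tensor_equivp])
  then have "free_lift f (rep_tensor (abs_tensor g) - g) = 0"
    unfolding tensor_rel_def by (rule free_lift_relator[OF assms])
  then show ?thesis
    by (simp add: tensor_lift_def L.diff)
qed

lemma tensor_lift_prod:
  assumes "cbilinear f" shows "tensor_lift f (u \<otimes> v) = f u v"
  by (simp add: tensor_prod.abs_eq tensor_lift_abs[OF assms] free_lift_single)

lemma clinear_tensor_lift:
  assumes "cbilinear f" shows "clinear (tensor_lift f)"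
proof (rule clinearI)
  interpret L: Vector_Spaces.linear scaleC scaleC "free_lift f" by (rule clinear_free_lift)
  fix s t :: "('a, 'b) tensor" and c
  obtain g h where gh: "s = abs_tensor g" "t = abs_tensor h"
    by (metis Quotient_abs_rep Quotient_tensor)
  show "tensor_lift f (s + t) = tensor_lift f s + tensor_lift f t"
    by (simp add: gh plus_tensor.abs_eq tensor_lift_abs[OF assms] L.add)
  show "tensor_lift f (c *\<^sub>C s) = c *\<^sub>C tensor_lift f s"
    by (simp add: gh scaleC_tensor.abs_eq tensor_lift_abs[OF assms] L.scale)
qed

lemma span_tensor_prod: "cv.span (\<Union>u v. {u \<otimes> v}) = UNIV"
proof -
  have "abs_tensor g \<in> cv.span (\<Union>u v. {u \<otimes> v})" for g :: "'a \<times> 'b \<Rightarrow>\<^sub>0 complex"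
  proof -
    have s: "abs_tensor (Poly_Mapping.single k c) \<in> cv.span (\<Union>u v. {u \<otimes> v})"
      for k :: "'a \<times> 'b" and c
    proof -
      have "Poly_Mapping.single k c = c *\<^sub>C Poly_Mapping.single k 1"
        by (rule poly_mapping_eqI)
          (auto simp: scaleC_poly_mapping.rep_eq scaleC_complex_def lookup_single when_def)
      then have "abs_tensor (Poly_Mapping.single k c) = c *\<^sub>C (fst k \<otimes> snd k)"
        by (simp add: tensor_prod.abs_eq scaleC_tensor.abs_eq)
      moreover have "fst k \<otimes> snd k \<in> cv.span (\<Union>u v. {u \<otimes> v})"
        by (rule cv.span_base) auto
      ultimately show ?thesis by (simp add: cv.span_scale)
    qed
    have "abs_tensor (\<Sum>k\<in>S. Poly_Mapping.single k (c k)) \<in> cv.span (\<Union>u v. {u \<otimes> v})"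
      if "finite S" for S :: "('a \<times> 'b) set" and c
      using that
    proof induction
      case empty
      show ?case using cv.span_zero by (simp add: zero_tensor.abs_eq[symmetric])
    next
      case (insert k S)
      then show ?case
        by (simp add: plus_tensor.abs_eq[symmetric] cv.span_add s)
    qed
    note sum_in = this
    have g: "g = (\<Sum>k\<in>Poly_Mapping.keys g. Poly_Mapping.single k (Poly_Mapping.lookup g k))"
      by (rule poly_mapping_eqI) (auto simp: lookup_sum lookup_single when_def in_keys_iff)
    show ?thesis by (subst g) (rule sum_in, simp)
  qed
  from this[of "rep_tensor t" for t] show ?thesis
    by (auto simp: Quotient3_abs_rep[OF Quotient3_tensor])
qed

lemma clinear_tensor_eqI:
  assumes "clinear F" "clinear G" "\<And>u v. F (u \<otimes> v) = G (u \<otimes> v)"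
  shows "F t = G t"
proof -
  interpret F: Vector_Spaces.linear scaleC scaleC F by fact
  interpret G: Vector_Spaces.linear scaleC scaleC G by fact
  have "t \<in> cv.span (\<Union>u v. {u \<otimes> v})" by (simp add: span_tensor_prod)
  then show ?thesis
  proof (induction rule: cv.span_induct_alt)
    case base
    show ?case by (simp add: F.zero G.zero)
  next
    case (step c x y)
    then show ?case using assms(3) by (auto simp: F.add G.add F.scale G.scale)
  qed
qed


section \<open>Super vector spaces\<close>

text \<open>A \<open>\<int>/2\<close>-grading is given by the projections \<open>hpart 0\<close> and \<open>hpart 1\<close> onto the
  even and the odd part.\<close>

class super_vector = cvector +
  fixes hpart :: "bit \<Rightarrow> 'a \<Rightarrow> 'a"
  assumes hpart_add: "hpart p (x + y) = hpart p x + hpart p y"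
    and hpart_scaleC: "hpart p (c *\<^sub>C x) = c *\<^sub>C hpart p x"
    and hpart_hpart: "hpart p (hpart q x) = (if p = q then hpart q x else 0)"
    and hpart_sum: "hpart 0 x + hpart 1 x = x"

definition homogeneous :: "bit \<Rightarrow> 'a::super_vector \<Rightarrow> bool"
  where "homogeneous p x \<longleftrightarrow> hpart p x = x"

definition koszul :: "bit \<Rightarrow> bit \<Rightarrow> complex"
  where "koszul p q = (if p = 1 \<and> q = 1 then -1 else 1)"

lemma clinear_hpart: "clinear (hpart p)"
  by (rule clinearI) (rule hpart_add hpart_scaleC)+

lemma hpart_zero [simp]: "hpart p 0 = 0"
  using hpart_scaleC[of p 0 0] by simp

lemma cbilinearI:
  assumes "\<And>u u' v. f (u + u') v = f u v + f u' v" "\<And>u v v'. f u (v + v') = f u v + f u v'"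
    "\<And>c u v. f (c *\<^sub>C u) v = c *\<^sub>C f u v" "\<And>c u v. f u (c *\<^sub>C v) = c *\<^sub>C f u v"
  shows "cbilinear f"
  unfolding cbilinear_def by (auto intro!: clinearI assms)

lemmas tensor_prod_simps = tensor_prod_add_left tensor_prod_add_right
  tensor_prod_scale_left tensor_prod_scale_right

lemma tensor_prod_zero [simp]: "0 \<otimes> v = 0" "u \<otimes> 0 = 0"
  using tensor_prod_scale_left[of 0 0 v] tensor_prod_scale_right[of u 0 0] by simp_all

instantiation tensor :: (super_vector, super_vector) super_vector
begin

definition hpart_tensor :: "bit \<Rightarrow> ('a, 'b) tensor \<Rightarrow> ('a, 'b) tensor"
  where "hpart_tensor p =
    tensor_lift (\<lambda>u v. hpart 0 u \<otimes> hpart p v + hpart 1 u \<otimes> hpart (p + 1) v)"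

lemma cbilinear_hpart_tensor:
  "cbilinear (\<lambda>(u :: 'a) (v :: 'b). hpart 0 u \<otimes> hpart p v + hpart 1 u \<otimes> hpart (p + 1) v)"
  by (rule cbilinearI)
    (simp_all add: hpart_add hpart_scaleC tensor_prod_simps scaleC_add_right)

lemma hpart_tensor_prod:
  "hpart p (u \<otimes> v) = hpart 0 u \<otimes> hpart p v + hpart 1 u \<otimes> hpart (p + 1) v"
  for u :: 'a and v :: 'b
  unfolding hpart_tensor_def by (rule tensor_lift_prod[OF cbilinear_hpart_tensor])

lemma clinear_hpart_tensor: "clinear (hpart p :: ('a, 'b) tensor \<Rightarrow> _)"
  unfolding hpart_tensor_def by (rule clinear_tensor_lift[OF cbilinear_hpart_tensor])

instance
proof
  fix p q :: bit and c and x y :: "('a, 'b) tensor"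
  show add: "hpart p (x + y) = hpart p x + hpart p y" for p and x y :: "('a, 'b) tensor"
    by (rule clinear_add[OF clinear_hpart_tensor])
  show scale: "hpart p (c *\<^sub>C x) = c *\<^sub>C hpart p x" for p c and x :: "('a, 'b) tensor"
    by (rule clinear_scale[OF clinear_hpart_tensor])
  have zero: "hpart p 0 = (0 :: ('a, 'b) tensor)" for p using scale[of p 0 0] by simp
  show "hpart 0 x + hpart 1 x = x"
  proof (rule clinear_tensor_eqI[where F = "\<lambda>x. hpart 0 x + hpart 1 x" and G = "\<lambda>x. x"])
    fix u :: 'a and v :: 'b
    have "u \<otimes> v = (hpart 0 u + hpart 1 u) \<otimes> (hpart 0 v + hpart 1 v)"
      by (simp only: hpart_sum)
    also have "\<dots> = hpart 0 (u \<otimes> v) + hpart 1 (u \<otimes> v)"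
      by (simp add: hpart_tensor_prod tensor_prod_add_left tensor_prod_add_right)
    finally show "hpart 0 (u \<otimes> v) + hpart 1 (u \<otimes> v) = u \<otimes> v" by simp
  qed (auto intro!: clinearI simp: add scale scaleC_add_right)
  show "hpart p (hpart q x) = (if p = q then hpart q x else 0)"
  proof (rule clinear_tensor_eqI[where F = "\<lambda>x. hpart p (hpart q x)"
        and G = "\<lambda>x. if p = q then hpart q x else 0"])
    fix u :: 'a and v :: 'b
    show "hpart p (hpart q (u \<otimes> v)) = (if p = q then hpart q (u \<otimes> v) else 0)"
      by (cases p; cases q) (simp_all add: hpart_tensor_prod add hpart_hpart)
  qed (auto intro!: clinearI simp: add scale scaleC_add_right)
qed

end

text \<open>\<open>super_tensor_op i a b\<close> is \<open>a \<otimes> b\<close> acting with the super sign rule, where \<open>b\<close> is an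
  operator of parity \<open>i\<close>.\<close>

definition super_tensor_op :: "bit \<Rightarrow> ('a \<Rightarrow> 'a) \<Rightarrow> ('b \<Rightarrow> 'b) \<Rightarrow>
    ('a::super_vector, 'b::super_vector) tensor \<Rightarrow> ('a, 'b) tensor"
  where "super_tensor_op i a b =
    tensor_lift (\<lambda>u v. koszul i 0 *\<^sub>C (a (hpart 0 u) \<otimes> b v) + koszul i 1 *\<^sub>C (a (hpart 1 u) \<otimes> b v))"

lemma cbilinear_super_tensor_op:
  assumes "clinear a" "clinear b"
  shows "cbilinear (\<lambda>u v. koszul i 0 *\<^sub>C (a (hpart 0 u) \<otimes> b v)
    + koszul i 1 *\<^sub>C (a (hpart 1 u) \<otimes> b v))"
  by (rule cbilinearI)
    (simp_all add: clinear_add[OF assms(1)] clinear_add[OF assms(2)] clinear_scale[OF assms(1)]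
      clinear_scale[OF assms(2)] hpart_add hpart_scaleC tensor_prod_simps
      scaleC_add_right scaleC_scaleC mult.commute)

lemma clinear_super_tensor_op:
  assumes "clinear a" "clinear b"
  shows "clinear (super_tensor_op i a b)"
  unfolding super_tensor_op_def
  by (rule clinear_tensor_lift[OF cbilinear_super_tensor_op[OF assms]])

lemma super_tensor_op_prod:
  assumes a: "clinear a" and b: "clinear b" and u: "homogeneous p u"
  shows "super_tensor_op i a b (u \<otimes> v) = koszul i p *\<^sub>C (a u \<otimes> b v)"
proof -
  have "a 0 = 0" using clinear_scale[OF a, of 0 0] by simp
  moreover have "hpart q u = (if q = p then u else 0)" for q
    using u hpart_hpart[of q p u] by (simp add: homogeneous_def)
  ultimately show ?thesis
    unfolding super_tensor_op_def tensor_lift_prod[OF cbilinear_super_tensor_op[OF a b]]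
    by (cases p) auto
qed


section \<open>The Lie superalgebra\<close>

datatype osp12_basis = X_m2 | X_m1 | X_h | X_p1 | X_p2

lemma UNIV_osp12_basis: "UNIV = {X_m2, X_m1, X_h, X_p1, X_p2}"
  using osp12_basis.exhaust by auto

instance osp12_basis :: finite
  by standard (simp add: UNIV_osp12_basis)

text \<open>Coordinates with respect to \<open>x\<^bsub>-2\<alpha>\<^esub>, x\<^bsub>-\<alpha>\<^esub>, h, x\<^bsub>\<alpha>\<^esub>, x\<^bsub>2\<alpha>\<^esub>\<close>; the scalar
  multiplication is \<^term>\<open>(*s)\<close>.\<close>

type_synonym osp12 = "complex ^ osp12_basis"

definition x_m2a :: osp12 where "x_m2a = axis X_m2 1"
definition x_ma :: osp12 where "x_ma = axis X_m1 1"
definition x_h :: osp12 where "x_h = axis X_h 1"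
definition x_a :: osp12 where "x_a = axis X_p1 1"
definition x_2a :: osp12 where "x_2a = axis X_p2 1"

fun basis_parity :: "osp12_basis \<Rightarrow> bit" where
  "basis_parity X_m1 = 1"
| "basis_parity X_p1 = 1"
| "basis_parity _ = 0"

definition osp_part :: "bit \<Rightarrow> osp12 \<Rightarrow> osp12"
  where "osp_part p x = (\<chi> b. if basis_parity b = p then x $ b else 0)"

text \<open>Besides the listed relations, these are the ones forced by super skew-symmetry
  \<open>[y, x] = - (-1)\<^bsup>|x||y|\<^esup> [x, y]\<close>; all others vanish.  As \<open>\<alpha>(h) = -1\<close>, bracketing
  with \<open>h\<close> multiplies \<open>x\<^bsub>k\<alpha>\<^esub>\<close> by \<open>-k\<close>.\<close>

fun basis_bracket :: "osp12_basis \<Rightarrow> osp12_basis \<Rightarrow> osp12" where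
  "basis_bracket X_h X_p1 = - x_a"
| "basis_bracket X_h X_p2 = (-2) *s x_2a"
| "basis_bracket X_h X_m1 = x_ma"
| "basis_bracket X_h X_m2 = 2 *s x_m2a"
| "basis_bracket X_p1 X_h = x_a"
| "basis_bracket X_p2 X_h = 2 *s x_2a"
| "basis_bracket X_m1 X_h = - x_ma"
| "basis_bracket X_m2 X_h = (-2) *s x_m2a"
| "basis_bracket X_m1 X_p1 = x_h"
| "basis_bracket X_p1 X_m1 = x_h"
| "basis_bracket X_m2 X_p2 = x_h"
| "basis_bracket X_p2 X_m2 = - x_h"
| "basis_bracket X_p1 X_p1 = (-2) *s x_2a"
| "basis_bracket X_m1 X_m1 = 2 *s x_m2a"
| "basis_bracket X_p1 X_m2 = x_ma"
| "basis_bracket X_m2 X_p1 = - x_ma"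
| "basis_bracket X_m1 X_p2 = x_a"
| "basis_bracket X_p2 X_m1 = - x_a"
| "basis_bracket _ _ = 0"

definition osp_bracket :: "osp12 \<Rightarrow> osp12 \<Rightarrow> osp12"
  where "osp_bracket x y = (\<Sum>a\<in>UNIV. \<Sum>b\<in>UNIV. (x $ a * y $ b) *s basis_bracket a b)"

definition n_minus :: "osp12 set"
  where "n_minus = {x. x $ X_h = 0 \<and> x $ X_p1 = 0 \<and> x $ X_p2 = 0}"


section \<open>Representations\<close>

definition super_rep :: "(osp12 \<Rightarrow> 'v::super_vector \<Rightarrow> 'v) \<Rightarrow> bool"
  where "super_rep \<rho> \<longleftrightarrow>
    (\<forall>x. clinear (\<rho> x)) \<and>
    (\<forall>v. Vector_Spaces.linear (*s) scaleC (\<lambda>x. \<rho> x v)) \<and>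
    (\<forall>p q x v. osp_part p x = x \<longrightarrow> homogeneous q v \<longrightarrow> homogeneous (p + q) (\<rho> x v)) \<and>
    (\<forall>p q x y v. osp_part p x = x \<longrightarrow> osp_part q y = y \<longrightarrow>
      \<rho> (osp_bracket x y) v = \<rho> x (\<rho> y v) - koszul p q *\<^sub>C \<rho> y (\<rho> x v))"

definition subrep :: "(osp12 \<Rightarrow> 'v::super_vector \<Rightarrow> 'v) \<Rightarrow> 'v set \<Rightarrow> bool"
  where "subrep \<rho> W \<longleftrightarrow> super_rep \<rho> \<and> cv.subspace W \<and>
    (\<forall>p. \<forall>v\<in>W. hpart p v \<in> W) \<and> (\<forall>x. \<forall>v\<in>W. \<rho> x v \<in> W)"

definition irreducible_subrep :: "(osp12 \<Rightarrow> 'v::super_vector \<Rightarrow> 'v) \<Rightarrow> 'v set \<Rightarrow> bool"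
  where "irreducible_subrep \<rho> W \<longleftrightarrow>
    subrep \<rho> W \<and> W \<noteq> {0} \<and> (\<forall>U. U \<subseteq> W \<longrightarrow> subrep \<rho> U \<longrightarrow> U = {0} \<or> U = W)"

text \<open>\<open>(\<rho>, v)\<close> is a copy of \<open>V(\<xi>)\<close> with its highest weight vector.\<close>

definition highest_weight_irrep :: "(osp12 \<Rightarrow> 'v::super_vector \<Rightarrow> 'v) \<Rightarrow> complex \<Rightarrow> 'v \<Rightarrow> bool"
  where "highest_weight_irrep \<rho> \<xi> v \<longleftrightarrow>
    irreducible_subrep \<rho> UNIV \<and> v \<noteq> 0 \<and>
    \<rho> x_h v = \<xi> *\<^sub>C v \<and> \<rho> x_a v = 0 \<and> \<rho> x_2a v = 0"

text \<open>The image in the endomorphism algebra of the enveloping algebra of a subalgebra \<open>S\<close>,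
  and the submodule \<open>U(S) w\<close>.\<close>

inductive_set enveloping_ops :: "(osp12 \<Rightarrow> 'v::cvector \<Rightarrow> 'v) \<Rightarrow> osp12 set \<Rightarrow> ('v \<Rightarrow> 'v) set"
  for \<rho> S where
  one: "(\<lambda>w. w) \<in> enveloping_ops \<rho> S"
| mult: "y \<in> S \<Longrightarrow> A \<in> enveloping_ops \<rho> S \<Longrightarrow> (\<lambda>w. \<rho> y (A w)) \<in> enveloping_ops \<rho> S"
| add: "A \<in> enveloping_ops \<rho> S \<Longrightarrow> B \<in> enveloping_ops \<rho> S \<Longrightarrow> (\<lambda>w. A w + B w) \<in> enveloping_ops \<rho> S"
| scale: "A \<in> enveloping_ops \<rho> S \<Longrightarrow> (\<lambda>w. c *\<^sub>C A w) \<in> enveloping_ops \<rho> S"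

definition U_submodule :: "(osp12 \<Rightarrow> 'v::cvector \<Rightarrow> 'v) \<Rightarrow> osp12 set \<Rightarrow> 'v \<Rightarrow> 'v set"
  where "U_submodule \<rho> S w = (\<lambda>A. A w) ` enveloping_ops \<rho> S"

text \<open>\<open>x \<otimes> 1\<close> and \<open>1 \<otimes> x\<close>.\<close>

definition act_left :: "(osp12 \<Rightarrow> 'v \<Rightarrow> 'v) \<Rightarrow> osp12 \<Rightarrow>
    ('v::super_vector, 'w::super_vector) tensor \<Rightarrow> ('v, 'w) tensor"
  where "act_left \<rho> x = super_tensor_op 0 (\<rho> x) (\<lambda>w. w)"

definition act_right :: "(osp12 \<Rightarrow> 'w \<Rightarrow> 'w) \<Rightarrow> osp12 \<Rightarrow>
    ('v::super_vector, 'w::super_vector) tensor \<Rightarrow> ('v, 'w) tensor"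
  where "act_right \<sigma> x t = super_tensor_op 0 (\<lambda>v. v) (\<sigma> (osp_part 0 x)) t
    + super_tensor_op 1 (\<lambda>v. v) (\<sigma> (osp_part 1 x)) t"

definition tensor_rep :: "(osp12 \<Rightarrow> 'v \<Rightarrow> 'v) \<Rightarrow> (osp12 \<Rightarrow> 'w \<Rightarrow> 'w) \<Rightarrow> osp12 \<Rightarrow>
    ('v::super_vector, 'w::super_vector) tensor \<Rightarrow> ('v, 'w) tensor"
  where "tensor_rep \<rho> \<sigma> x t = act_left \<rho> x t + act_right \<sigma> x t"

definition tensor_diff :: "(osp12 \<Rightarrow> 'v \<Rightarrow> 'v) \<Rightarrow> (osp12 \<Rightarrow> 'w \<Rightarrow> 'w) \<Rightarrow> osp12 \<Rightarrow>
    ('v::super_vector, 'w::super_vector) tensor \<Rightarrow> ('v, 'w) tensor"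
  where "tensor_diff \<rho> \<sigma> x t = act_left \<rho> x t - act_right \<sigma> x t"

text \<open>The operator raised to the \<open>j\<close>-th power in the decomposition, with \<open>X = X\<^bsub>-\<alpha>\<^esub>\<close>;
  \<open>inv\<close> is meaningful because \<open>H - 1\<close> and \<open>H - 2\<close> are bijective on the spaces considered.\<close>

definition step_op :: "(osp12 \<Rightarrow> 'v \<Rightarrow> 'v) \<Rightarrow> (osp12 \<Rightarrow> 'w \<Rightarrow> 'w) \<Rightarrow>
    ('v::super_vector, 'w::super_vector) tensor \<Rightarrow> ('v, 'w) tensor"
  where "step_op \<rho> \<sigma> t =
    (let X = tensor_rep \<rho> \<sigma> x_ma;
         Hm1 = (\<lambda>w. tensor_rep \<rho> \<sigma> x_h w - w);
         Hm2 = (\<lambda>w. tensor_rep \<rho> \<sigma> x_h w - 2 *\<^sub>C w)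
     in tensor_diff \<rho> \<sigma> x_ma t
        - inv Hm1 (X (tensor_diff \<rho> \<sigma> x_h t))
        - inv Hm1 ((X ^^ 2) (tensor_diff \<rho> \<sigma> x_a t))
        - 2 *\<^sub>C inv (Hm2 \<circ> Hm1) ((X ^^ 3) (tensor_diff \<rho> \<sigma> x_2a t)))"


section \<open>The polynomial representation\<close>

instantiation poly :: (cvector) super_vector
begin

definition scaleC_poly :: "complex \<Rightarrow> 'a poly \<Rightarrow> 'a poly"
  where "scaleC_poly c f = map_poly (scaleC c) f"

definition hpart_poly :: "bit \<Rightarrow> 'a poly \<Rightarrow> 'a poly"
  where "hpart_poly p f = (\<Sum>n\<le>degree f. if of_nat n = p then monom (coeff f n) n else 0)"

lemma coeff_scaleC: "coeff (c *\<^sub>C f) n = c *\<^sub>C coeff f n" for f :: "'a poly"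
  by (simp add: scaleC_poly_def coeff_map_poly)

lemma coeff_hpart: "coeff (hpart p f) n = (if of_nat n = p then coeff f n else 0)"
  for f :: "'a poly"
proof -
  have "coeff (hpart p f) n
      = (\<Sum>m\<le>degree f. if m = n then (if of_nat n = p then coeff f n else 0) else 0)"
    unfolding hpart_poly_def coeff_sum by (rule sum.cong) auto
  then show ?thesis by (auto simp: coeff_eq_0)
qed

instance
proof
  fix f :: "'a poly"
  show "hpart 0 f + hpart 1 f = f"
  proof (rule poly_eqI)
    fix n show "coeff (hpart 0 f + hpart 1 f) n = coeff f n"
      by (cases "of_nat n :: bit") (simp_all add: coeff_hpart)
  qed
qed (auto intro!: poly_eqI simp: coeff_scaleC coeff_hpart
    scaleC_add_right scaleC_add_left scaleC_scaleC scaleC_one)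

end

lemma scaleC_poly_complex: "c *\<^sub>C f = smult c f" for f :: "complex poly"
  by (rule poly_eqI) (simp add: coeff_scaleC scaleC_complex_def)

text \<open>\<open>x\<^bsub>\<alpha>\<^esub>\<close> acts by \<open>a d/dx\<close> and \<open>x\<^bsub>-\<alpha>\<^esub>\<close> by \<open>b x\<close>, where \<open>a b = 1/2\<close>.
  The action of \<open>x\<^bsub>\<plusminus>2\<alpha>\<^esub>\<close> is forced by \<open>[x\<^bsub>\<plusminus>\<alpha>\<^esub>, x\<^bsub>\<plusminus>\<alpha>\<^esub>] = \<minusplus>2 x\<^bsub>\<plusminus>2\<alpha>\<^esub>\<close>.\<close>

definition poly_rep :: "complex \<Rightarrow> complex \<Rightarrow> osp12 \<Rightarrow> complex poly \<Rightarrow> complex poly"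
  where "poly_rep a b x f =
      smult (x $ X_m2 * b\<^sup>2) ([:0, 1:] * ([:0, 1:] * f))
    + smult (x $ X_m1 * b) ([:0, 1:] * f)
    + smult (x $ X_h) ([:0, 1:] * pderiv f + smult (1/2) f)
    + smult (x $ X_p1 * a) (pderiv f)
    - smult (x $ X_p2 * a\<^sup>2) (pderiv (pderiv f))"

lemma poly_rep_pCons:
  "poly_rep a b x f =
      smult (x $ X_m2 * b\<^sup>2) (pCons 0 (pCons 0 f))
    + smult (x $ X_m1 * b) (pCons 0 f)
    + smult (x $ X_h) (pCons 0 (pderiv f) + smult (1/2) f)
    + smult (x $ X_p1 * a) (pderiv f)
    - smult (x $ X_p2 * a\<^sup>2) (pderiv (pderiv f))"
  by (simp add: poly_rep_def)

lemma coeff_poly_rep: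
  "coeff (poly_rep a b x f) n =
      x $ X_m2 * b\<^sup>2 * (if n < 2 then 0 else coeff f (n - 2))
    + x $ X_m1 * b * (if n < 1 then 0 else coeff f (n - 1))
    + x $ X_h * (of_nat n + 1/2) * coeff f n
    + x $ X_p1 * a * of_nat (n + 1) * coeff f (n + 1)
    - x $ X_p2 * a\<^sup>2 * of_nat (n + 1) * of_nat (n + 2) * coeff f (n + 2)"
proof -
  consider "n = 0" | "n = 1" | m where "n = Suc (Suc m)"
    by (metis One_nat_def old.nat.exhaust)
  then show ?thesis
    by cases (simp_all add: poly_rep_pCons coeff_pCons coeff_pderiv algebra_simps)
qed

lemma osp_part_fixed:
  "osp_part 0 x = x \<longleftrightarrow> x $ X_m1 = 0 \<and> x $ X_p1 = 0"
  "osp_part 1 x = x \<longleftrightarrow> x $ X_m2 = 0 \<and> x $ X_h = 0 \<and> x $ X_p2 = 0"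
proof -
  have a: "(\<forall>i. P i) \<longleftrightarrow> P X_m2 \<and> P X_m1 \<and> P X_h \<and> P X_p1 \<and> P X_p2" for P
    by (metis osp12_basis.exhaust)
  show "osp_part 0 x = x \<longleftrightarrow> x $ X_m1 = 0 \<and> x $ X_p1 = 0"
    "osp_part 1 x = x \<longleftrightarrow> x $ X_m2 = 0 \<and> x $ X_h = 0 \<and> x $ X_p2 = 0"
    by (auto simp: osp_part_def vec_eq_iff a)
qed

lemma osp_bracket_nth:
  "osp_bracket x y $ X_m2 = 2 * (x $ X_h * y $ X_m2 - x $ X_m2 * y $ X_h) + 2 * x $ X_m1 * y $ X_m1"
  "osp_bracket x y $ X_m1 = x $ X_h * y $ X_m1 - x $ X_m1 * y $ X_h
     + x $ X_p1 * y $ X_m2 - x $ X_m2 * y $ X_p1"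
  "osp_bracket x y $ X_h = x $ X_m1 * y $ X_p1 + x $ X_p1 * y $ X_m1
     + x $ X_m2 * y $ X_p2 - x $ X_p2 * y $ X_m2"
  "osp_bracket x y $ X_p1 = x $ X_p1 * y $ X_h - x $ X_h * y $ X_p1
     + x $ X_m1 * y $ X_p2 - x $ X_p2 * y $ X_m1"
  "osp_bracket x y $ X_p2 = 2 * (x $ X_p2 * y $ X_h - x $ X_h * y $ X_p2) - 2 * x $ X_p1 * y $ X_p1"
  by (simp_all add: osp_bracket_def UNIV_osp12_basis x_m2a_def x_ma_def x_h_def x_a_def x_2a_def
      axis_def algebra_simps)

lemma super_rep_poly_rep:
  assumes ab: "a * b = 1 / 2"
  shows "super_rep (poly_rep a b)"
  unfolding super_rep_def
proof (intro conjI allI impI)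
  fix x :: osp12 and f :: "complex poly"
  show "clinear (poly_rep a b x)" for x
    by (rule clinearI; rule poly_eqI)
       (auto simp: coeff_poly_rep scaleC_poly_complex algebra_simps)
  show "Vector_Spaces.linear (*s) scaleC (\<lambda>x. poly_rep a b x f)" for f
    unfolding Vector_Spaces.linear_iff
    by (auto intro!: poly_eqI vec.vector_space_axioms cv.vector_space_axioms simp: coeff_poly_rep scaleC_poly_complex algebra_simps)
next
  fix p q :: bit and x :: osp12 and f :: "complex poly"
  assume x: "osp_part p x = x" and f: "homogeneous q f"
  have c: "coeff f n = 0" if "of_nat n \<noteq> q" for n
    using f that unfolding homogeneous_def by (metis coeff_hpart)
  show "homogeneous (p + q) (poly_rep a b x f)"
    unfolding homogeneous_def
  proof (rule poly_eqI)
    fix n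
    have e: "of_nat (n - 2) = (of_nat n :: bit)" if "n \<ge> 2"
      using that by (auto simp: of_nat_diff)
    have o: "of_nat (n - 1) = (of_nat n + 1 :: bit)" if "n \<ge> 1"
      using that by (auto simp: of_nat_diff)
    have r: "of_nat (n + 1) = (of_nat n + 1 :: bit)" "of_nat (n + 2) = (of_nat n :: bit)" by auto
    show "coeff (hpart (p + q) (poly_rep a b x f)) n = coeff (poly_rep a b x f) n"
    proof (cases "of_nat n = p + q")
      case False
      then have "coeff (poly_rep a b x f) n = 0"
        using x e o r c[of n] c[of "n - 1"] c[of "n - 2"] c[of "n + 1"] c[of "n + 2"]
        by (cases p; cases q) (auto simp: coeff_poly_rep osp_part_fixed)
      then show ?thesis by (simp add: coeff_hpart)
    qed (simp add: coeff_hpart)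
  qed
next
  fix p q :: bit and x y :: osp12 and f :: "complex poly"
  assume x: "osp_part p x = x" and y: "osp_part q y = y"
  have "a \<noteq> 0" using ab by auto
  then have b: "b = 1 / (2 * a)" using ab by (simp add: nonzero_eq_divide_eq mult_ac)
  show "poly_rep a b (osp_bracket x y) f
      = poly_rep a b x (poly_rep a b y f) - koszul p q *\<^sub>C poly_rep a b y (poly_rep a b x f)"
  proof (rule poly_eqI)
    fix n :: nat
    have "n = 0 \<or> n = 1 \<or> n = 2 \<or> n = 3 \<or> (\<exists>m. n = m + 4)" by presburger
    with x y show "coeff (poly_rep a b (osp_bracket x y) f) n = coeff (poly_rep a b x (poly_rep a b y f)
        - koszul p q *\<^sub>C poly_rep a b y (poly_rep a b x f)) n"
      using \<open>a \<noteq> 0\<close>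
      by - (cases p; cases q; elim disjE exE; simp add: coeff_poly_rep osp_bracket_nth osp_part_fixed koszul_def b scaleC_poly_complex
          field_simps power2_eq_square numeral_eq_Suc)
  qed
qed

lemma highest_weight_irrep_poly_rep:
  assumes ab: "a * b = 1 / 2"
  shows "highest_weight_irrep (poly_rep a b) (1 / 2) 1"
proof -
  have [simp]: "a \<noteq> 0" "b \<noteq> 0" using ab by auto
  note rep = super_rep_poly_rep[OF ab]
  have xa: "poly_rep a b x_a f = smult a (pderiv f)" for f
    by (simp add: poly_rep_pCons x_a_def axis_def)
  have xma: "poly_rep a b x_ma f = smult b (pCons 0 f)" for f
    by (simp add: poly_rep_pCons x_ma_def axis_def)
  have "U = UNIV" if U: "subrep (poly_rep a b) U" and "U \<noteq> {0}" for U
  proof -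
    have sub: "cv.subspace U" and act: "\<And>x f. f \<in> U \<Longrightarrow> poly_rep a b x f \<in> U"
      using U by (auto simp: subrep_def)
    have sm: "smult c f \<in> U" if "f \<in> U" for c f
      using cv.subspace_scale[OF sub that, of c] by (simp add: scaleC_poly_complex)
    have "pderiv f \<in> U" if "f \<in> U" for f
      using sm[OF act[OF that, of x_a], of "inverse a"] by (simp add: xa)
    have one: "1 \<in> U" if "f \<in> U" "f \<noteq> 0" for f
      using that
    proof (induction "degree f" arbitrary: f)
      case 0
      then obtain c where "f = [:c:]" by (metis degree_eq_zeroE)
      with 0 show ?case using sm[of f "inverse c"] by (simp add: one_pCons)
    next
      case (Suc n)
      then show ?case
        by (metis \<open>\<And>f. f \<in> U \<Longrightarrow> pderiv f \<in> U\<close> degree_pderiv diff_Suc_1 nat.distinct(1) pderiv_eq_0_iff)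
    qed
    have "0 \<in> U" using sub by (rule cv.subspace_0)
    then have 1: "1 \<in> U" using one \<open>U \<noteq> {0}\<close> by blast
    have X: "pCons 0 f \<in> U" if "f \<in> U" for f
      using sm[OF act[OF that, of x_ma], of "inverse b"] by (simp add: xma)
    have "f \<in> U" for f
    proof (induction f)
      case 0
      show ?case by fact
    next
      case (pCons c f)
      have "smult c 1 + pCons 0 f \<in> U" by (intro cv.subspace_add[OF sub] sm 1 X pCons)
      then show ?case by (simp add: one_pCons)
    qed
    then show ?thesis by auto
  qed
  moreover have "subrep (poly_rep a b) UNIV" using rep by (simp add: subrep_def)
  moreover have "poly_rep a b x_h 1 = (1 / 2) *\<^sub>C 1"
    by (simp add: poly_rep_pCons x_h_def axis_def scaleC_poly_complex)
  moreover have "poly_rep a b x_2a 1 = 0"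
    by (simp add: poly_rep_pCons x_2a_def axis_def)
  moreover have "(UNIV :: complex poly set) \<noteq> {0}" by (metis UNIV_I singletonD one_neq_zero)
  ultimately show ?thesis
    unfolding highest_weight_irrep_def irreducible_subrep_def by (auto simp: xa)
qed

end

theory Submission
  imports Defs
begin

text \<open>
  Write \<open>e\<close>, \<open>f\<close>, \<open>h\<close> for the actions of \<open>x\<^sub>\<alpha>\<close>, \<open>x\<^bsub>-\<alpha>\<^esub>\<close>, \<open>h\<close>.  Since \<open>x\<^bsub>2\<alpha>\<^esub>\<close> acts by
  \<open>-e\<^sup>2\<close> and \<open>x\<^bsub>-2\<alpha>\<^esub>\<close> by \<open>f\<^sup>2\<close>, everything is governed by these three operators.  Call \<open>w\<close> singular of
  weight \<open>\<mu>\<close> if \<open>h w = \<mu> w\<close> and \<open>e w = 0\<close>.  Then \<open>U(n\<^sub>-) w\<close> is the span of the \<open>f\<^sup>k w\<close>, and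
  \<open>e f\<^sup>k w = c\<^sub>k f\<^bsup>k-1\<^esup> w\<close> with \<open>c\<^sub>k = k/2\<close> for even \<open>k\<close> and \<open>c\<^sub>k = \<mu> + (k-1)/2\<close> for odd \<open>k\<close>.  In the
  tensor product all weights are half-integers, so that no \<open>c\<^sub>k\<close> with \<open>k \<ge> 1\<close> vanishes: from every
  nonzero vector of \<open>U(n\<^sub>-) w\<close> one gets back to \<open>w\<close> by raising, and \<open>U(n\<^sub>-) w\<close> is irreducible
  (\<open>irreducible_lowered_span\<close>).  What has to be understood is therefore the kernel of \<open>e\<close>.

  The operators \<open>x\<^sub>\<beta> \<otimes> 1 - 1 \<otimes> x\<^sub>\<beta>\<close> transform under the diagonal action like the adjoint
  representation (\<open>tensor_rep_diff_bracket\<close>).  This makes the four terms of the step operator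
  cancel under \<open>e\<close>, so the step operator sends singular vectors of weight \<open>\<mu>\<close> to singular vectors
  of weight \<open>\<mu> + 1\<close> (\<open>singular_step_vector\<close>).

  To see that nothing is lost on the way, expand a tensor as \<open>\<Sum> x\<^sup>n \<otimes> t\<^sub>n\<close>.  The equation \<open>e t = 0\<close>
  expresses \<open>t\<^bsub>n+1\<^esub>\<close> through \<open>t\<^sub>n\<close>, so a vector in the kernel of \<open>e\<close> is determined by \<open>t\<^sub>0 \<in> V(-\<ell>)\<close>
  (\<open>kernel_component_0\<close>).  In these terms the step operator is \<open>f\<close> up to a scalar
  (\<open>component_0_step_vector\<close>), and the scalar is nonzero (\<open>step_coeff_neq_0\<close>).  Consequently the
  vector produced by \<open>j\<close> steps from \<open>1 \<otimes> v\<^sub>\<ell>\<close> corresponds to a nonzero multiple of \<open>f\<^sup>j v\<^sub>\<ell>\<close>, and the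
  vectors with \<open>j \<le> 2\<ell>\<close> form a basis of the kernel of \<open>e\<close>.

  Finally \<open>e\<close> is locally nilpotent and maps each \<open>U(n\<^sub>-) w\<^sub>j\<close> onto itself.  An induction on the power of
  \<open>e\<close> that kills a vector shows that the sum of these modules is everything
  (\<open>in_sum_if_nilpotent\<close>), and another one that the sum is direct (\<open>sum_eq_0_if_nilpotent\<close>).
\<close>

section \<open>Linear algebra\<close>

text \<open>Linear independence of eigenvectors with distinct eigenvalues, for families: vanishing
  members are admitted, which lets strings of weight vectors be treated without knowing where they
  break off.\<close>

lemma eigenvector_sum_eq_0:
  assumes T: "clinear T" and "finite S"
    and "\<And>k. k \<in> S \<Longrightarrow> T (y k) = \<mu> k *\<^sub>C y k"
    and "inj_on \<mu> S" and "(\<Sum>k\<in>S. y k) = 0" and "k \<in> S"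
  shows "y k = 0"
proof -
  interpret T: Vector_Spaces.linear scaleC scaleC T by fact
  have "\<forall>k\<in>S. y k = 0"
    using assms(2-5)
  proof (induction S arbitrary: y)
    case (insert s S)
    \<comment> \<open>Applying \<open>T - \<mu> s\<close> removes the summand with index \<open>s\<close>.\<close>
    have "(\<Sum>k\<in>S. (\<mu> k - \<mu> s) *\<^sub>C y k)
        = (\<Sum>k\<in>insert s S. \<mu> k *\<^sub>C y k) - \<mu> s *\<^sub>C (\<Sum>k\<in>insert s S. y k)"
      using insert.hyps
      by (simp add: cv.scale_left_diff_distrib sum_subtractf cv.scale_sum_right scaleC_add_right)
    also have "(\<Sum>k\<in>insert s S. \<mu> k *\<^sub>C y k) = T (\<Sum>k\<in>insert s S. y k)"
      unfolding T.sum by (intro sum.cong refl) (simp add: insert.prems)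
    finally have "(\<Sum>k\<in>S. (\<mu> k - \<mu> s) *\<^sub>C y k) = 0"
      by (simp add: insert.prems T.zero)
    moreover have "T ((\<mu> k - \<mu> s) *\<^sub>C y k) = \<mu> k *\<^sub>C (\<mu> k - \<mu> s) *\<^sub>C y k" if "k \<in> S" for k
      using that by (simp add: T.scale insert.prems scaleC_scaleC mult.commute)
    moreover have "inj_on \<mu> S" using insert.prems(2) by (rule inj_on_subset) blast
    ultimately have zero: "\<forall>k\<in>S. (\<mu> k - \<mu> s) *\<^sub>C y k = 0"
      by (intro insert.IH)
    have ne: "\<mu> k \<noteq> \<mu> s" if "k \<in> S" for k
      using inj_onD[OF insert.prems(2), of k s] that insert.hyps(2) by auto
    have y: "y k = 0" if "k \<in> S" for k
      using bspec[OF zero that] ne[OF that] by simp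
    then have "y s = 0" using insert.prems(3) insert.hyps by simp
    with y show ?case by simp
  qed simp
  with \<open>k \<in> S\<close> show ?thesis by blast
qed

lemma span_range_sum:
  assumes "u \<in> cv.span (range g)"
  obtains n and c :: "nat \<Rightarrow> complex" where "u = (\<Sum>k<n. c k *\<^sub>C g k)"
proof -
  have "\<exists>n c. (u::'a::cvector) = (\<Sum>k<n. c k *\<^sub>C g k)"
    using assms
  proof (induction rule: cv.span_induct_alt)
    case base
    show ?case by (rule exI[of _ 0]) simp
  next
    case (step r x u)
    then obtain i n c where i: "x = g i" and u: "u = (\<Sum>k<n. c k *\<^sub>C g k)" by blast
    define c' where "c' k = (if k = i then r else 0) + (if k < n then c k else 0)" for k
    let ?N = "Suc (max n i)"
    have "(\<Sum>k<?N. c' k *\<^sub>C g k) = (\<Sum>k<?N. if k = i then r *\<^sub>C g k else 0)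
        + (\<Sum>k<?N. if k < n then c k *\<^sub>C g k else 0)"
      unfolding sum.distrib[symmetric]
      by (intro sum.cong) (auto simp: c'_def scaleC_add_left)
    also have "(\<Sum>k<?N. if k = i then r *\<^sub>C g k else 0) = r *\<^sub>C g i"
      by (subst sum.delta) auto
    also have "(\<Sum>k<?N. if k < n then c k *\<^sub>C g k else 0) = u"
      unfolding u by (rule sum.mono_neutral_cong_right) auto
    finally show ?case unfolding i by (intro exI[of _ ?N] exI[of _ c']) simp
  qed
  with that show ?thesis by blast
qed

lemma is_direct_sumI:
  assumes "finite I" and sub: "\<And>i. i \<in> I \<Longrightarrow> cv.subspace (W i)"
    and span: "cv.span (\<Union>i\<in>I. W i) = UNIV"
    and indep: "\<And>u. (\<And>i. i \<in> I \<Longrightarrow> u i \<in> W i) \<Longrightarrow> (\<Sum>i\<in>I. u i) = 0 \<Longrightarrow> \<forall>i\<in>I. u i = 0"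
  shows "is_direct_sum I W"
  unfolding is_direct_sum_def
proof (intro conjI ballI allI)
  fix w
  have "w \<in> cv.span (\<Union>i\<in>I. W i)" by (simp add: span)
  then have "\<exists>f. (\<forall>i\<in>I. f i \<in> W i) \<and> w = (\<Sum>i\<in>I. f i)"
  proof (induction rule: cv.span_induct_alt)
    case base
    show ?case by (rule exI[of _ "\<lambda>_. 0"]) (auto simp: sub cv.subspace_0)
  next
    case (step c x y)
    then obtain j f where j: "j \<in> I" "x \<in> W j" and f: "\<forall>i\<in>I. f i \<in> W i" "y = (\<Sum>i\<in>I. f i)"
      by blast
    let ?f = "\<lambda>i. (if i = j then c *\<^sub>C x else 0) + f i"
    have "\<forall>i\<in>I. ?f i \<in> W i"
      using f j sub by (auto intro: cv.subspace_add cv.subspace_scale)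
    moreover have "(\<Sum>i\<in>I. ?f i) = c *\<^sub>C x + y"
      using j \<open>finite I\<close> by (simp add: sum.distrib f)
    ultimately show ?case by (intro exI[of _ ?f]) simp
  qed
  then obtain f where f: "\<forall>i\<in>I. f i \<in> W i" "w = (\<Sum>i\<in>I. f i)" by blast
  show "\<exists>!f. (\<forall>i\<in>I. f i \<in> W i) \<and> (\<forall>i. i \<notin> I \<longrightarrow> f i = 0) \<and> w = (\<Sum>i\<in>I. f i)"
  proof (rule ex1I[of _ "\<lambda>i. if i \<in> I then f i else 0"])
    show "(\<forall>i\<in>I. (if i \<in> I then f i else 0) \<in> W i) \<and> (\<forall>i. i \<notin> I \<longrightarrow> (if i \<in> I then f i else 0) = 0)
        \<and> w = (\<Sum>i\<in>I. if i \<in> I then f i else 0)"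
      using f by simp
  next
    fix g assume g: "(\<forall>i\<in>I. g i \<in> W i) \<and> (\<forall>i. i \<notin> I \<longrightarrow> g i = 0) \<and> w = (\<Sum>i\<in>I. g i)"
    have "\<forall>i\<in>I. g i - f i = 0"
      by (rule indep) (use f g sub in \<open>auto simp: sum_subtractf intro: cv.subspace_diff\<close>)
    then show "g = (\<lambda>i. if i \<in> I then f i else 0)" using g by auto
  qed
qed (use assms in auto)


lemma scaleC_double: "(2 :: complex) *\<^sub>C y = y + y"
  using scaleC_add_left[of 1 1 y] by (simp add: scaleC_one)

lemma clinear_diff:
  assumes "clinear F" shows "F (x - y) = F x - F y"
proof -
  interpret F: Vector_Spaces.linear scaleC scaleC F by fact
  show ?thesis by (rule F.diff)
qed

lemma clinear_compose: "clinear F \<Longrightarrow> clinear G \<Longrightarrow> clinear (\<lambda>t. F (G t))"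
  by (auto intro!: clinearI simp: clinear_add clinear_scale)

lemma clinear_plus: "clinear F \<Longrightarrow> clinear G \<Longrightarrow> clinear (\<lambda>t. F t + G t)"
  by (auto intro!: clinearI simp: clinear_add clinear_scale scaleC_add_right)

lemma clinear_minus: "clinear F \<Longrightarrow> clinear G \<Longrightarrow> clinear (\<lambda>t. F t - G t)"
  by (auto intro!: clinearI simp: clinear_add clinear_scale cv.scale_right_diff_distrib)

lemma clinear_scaled: "clinear F \<Longrightarrow> clinear (\<lambda>t. c *\<^sub>C F t)"
  by (auto intro!: clinearI simp: clinear_add clinear_scale scaleC_add_right scaleC_scaleC mult.commute)

lemma clinear_id: "clinear (\<lambda>t. t)"
  by (auto intro!: clinearI)

lemma clinear_span_closed:
  assumes "clinear F" and gen: "\<And>x. x \<in> B \<Longrightarrow> F x \<in> cv.span C" and "u \<in> cv.span B"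
  shows "F u \<in> cv.span C"
proof -
  interpret F: Vector_Spaces.linear scaleC scaleC F by fact
  from \<open>u \<in> cv.span B\<close> show ?thesis
  proof (induction rule: cv.span_induct_alt)
    case base
    show ?case by (simp add: F.zero cv.span_zero)
  next
    case (step c x y)
    then show ?case by (simp add: F.add F.scale gen cv.span_add cv.span_scale)
  qed
qed

section \<open>Representations\<close>

lemma osp_forall: "(\<forall>i. P i) \<longleftrightarrow> P X_m2 \<and> P X_m1 \<and> P X_h \<and> P X_p1 \<and> P X_p2"
  by (metis osp12_basis.exhaust)

lemmas osp_basis_defs = x_m2a_def x_ma_def x_h_def x_a_def x_2a_def

lemma osp_part_basis [simp]:
  "osp_part 0 x_m2a = x_m2a" "osp_part 1 x_ma = x_ma" "osp_part 0 x_h = x_h"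
  "osp_part 1 x_a = x_a" "osp_part 0 x_2a = x_2a"
  by (simp_all add: osp_part_fixed osp_basis_defs axis_def)

lemma osp_bracket_basis:
  "osp_bracket x_a x_a = (-2) *s x_2a" "osp_bracket x_ma x_ma = 2 *s x_m2a"
  "osp_bracket x_a x_ma = x_h" "osp_bracket x_a x_h = x_a" "osp_bracket x_a x_2a = 0"
  "osp_bracket x_h x_ma = x_ma" "osp_bracket x_h x_a = - x_a" "osp_bracket x_h x_h = 0"
  "osp_bracket x_h x_2a = (-2) *s x_2a"
  by (simp_all add: vec_eq_iff osp_forall osp_bracket_nth osp_basis_defs axis_def)

text \<open>Reduces the action of an arbitrary element to that of the five basis elements.\<close>

lemma osp_basis_expansion:
  "x = x $ X_m2 *s x_m2a + x $ X_m1 *s x_ma + x $ X_h *s x_h + x $ X_p1 *s x_a + x $ X_p2 *s x_2a"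
  by (simp add: vec_eq_iff osp_forall osp_basis_defs axis_def)

lemma osp_part_osp_part: "osp_part p (osp_part q x) = (if p = q then osp_part q x else 0)"
  by (simp add: osp_part_def vec_eq_iff)

lemma osp_part_add: "osp_part p (x + y) = osp_part p x + osp_part p y"
  and osp_part_scale: "osp_part p (c *s x) = c *s osp_part p x"
  by (simp_all add: osp_part_def vec_eq_iff)

lemma osp_part_fixed_other:
  assumes "osp_part p x = x" shows "osp_part q x = (if q = p then x else 0)"
  by (metis assms osp_part_osp_part)

lemma homogeneous_other: "homogeneous p u \<Longrightarrow> hpart q u = (if q = p then u else 0)"
  by (metis homogeneous_def hpart_hpart)

lemma homogeneous_hpart: "homogeneous p (hpart p u)"
  by (simp add: homogeneous_def hpart_hpart)

locale osp_rep =
  fixes \<rho> :: "osp12 \<Rightarrow> 'v::super_vector \<Rightarrow> 'v"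
  assumes rep: "super_rep \<rho>"
begin

lemma clinear_rep: "clinear (\<rho> x)"
  using rep by (simp add: super_rep_def)

sublocale L: Vector_Spaces.linear scaleC scaleC "\<rho> x" for x
  by (rule clinear_rep)

lemma clinear_arg: "Vector_Spaces.linear (*s) scaleC (\<lambda>x. \<rho> x v)"
  using rep by (simp add: super_rep_def)

lemma rep_add_arg: "\<rho> (x + y) v = \<rho> x v + \<rho> y v"
  and rep_scale_arg: "\<rho> (c *s x) v = c *\<^sub>C \<rho> x v"
  using clinear_arg[of v] by (simp_all add: Vector_Spaces.linear_iff)

lemma rep_zero_arg [simp]: "\<rho> 0 v = 0"
  using rep_scale_arg[of 0 0 v] by simp

lemma rep_minus_arg: "\<rho> (- x) v = - \<rho> x v"
  using rep_add_arg[of x "- x" v] by (simp add: eq_neg_iff_add_eq_0 add.commute)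

text \<open>The parity axiom for homogeneous vectors is equivalent to this commutation rule, which needs
  no case distinction on the vector.\<close>

lemma hpart_rep:
  assumes x: "osp_part p x = x"
  shows "hpart (p + q) (\<rho> x v) = \<rho> x (hpart q v)"
proof -
  have h: "homogeneous (p + r) (\<rho> x (hpart r v))" for r
    using rep x homogeneous_hpart[of r v] unfolding super_rep_def by blast
  have "hpart (p + q) (\<rho> x v) = hpart (p + q) (\<rho> x (hpart 0 v)) + hpart (p + q) (\<rho> x (hpart 1 v))"
    by (metis L.add hpart_add hpart_sum)
  also have "\<dots> = \<rho> x (hpart q v)"
    using homogeneous_other[OF h[of 0], of "p + q"] homogeneous_other[OF h[of 1], of "p + q"]
    by (cases p; cases q) auto
  finally show ?thesis .
qed

lemma rep_bracket:
  assumes "osp_part p x = x" "osp_part q y = y"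
  shows "\<rho> x (\<rho> y v) = \<rho> (osp_bracket x y) v + koszul p q *\<^sub>C \<rho> y (\<rho> x v)"
  using rep assms by (simp add: super_rep_def)

lemma rep_a_ma: "\<rho> x_a (\<rho> x_ma v) = \<rho> x_h v - \<rho> x_ma (\<rho> x_a v)"
  using rep_bracket[of 1 x_a 1 x_ma v] by (simp add: osp_bracket_basis koszul_def)

lemma rep_h_ma: "\<rho> x_h (\<rho> x_ma v) = \<rho> x_ma (\<rho> x_h v) + \<rho> x_ma v"
  using rep_bracket[of 0 x_h 1 x_ma v] by (simp add: osp_bracket_basis koszul_def)

text \<open>Both long root vectors are squares of short ones up to sign, because
  \<open>[x\<^bsub>\<plusminus>\<alpha>\<^esub>, x\<^bsub>\<plusminus>\<alpha>\<^esub>] = 2 x\<^bsub>\<plusminus>\<alpha>\<^esub>\<^sup>2\<close> for odd elements.  Hence it suffices to control \<open>x\<^bsub>\<plusminus>\<alpha>\<^esub>\<close> and \<open>h\<close>.\<close>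

lemma rep_2a: "\<rho> x_2a v = - \<rho> x_a (\<rho> x_a v)"
proof -
  have "\<rho> x_a (\<rho> x_a v) = (-2) *\<^sub>C \<rho> x_2a v - \<rho> x_a (\<rho> x_a v)"
    using rep_bracket[of 1 x_a 1 x_a v] by (simp add: osp_bracket_basis koszul_def rep_scale_arg rep_minus_arg)
  then have "\<rho> x_a (\<rho> x_a v) + \<rho> x_a (\<rho> x_a v) = (-2) *\<^sub>C \<rho> x_2a v"
    by (metis diff_add_cancel)
  then have "2 *\<^sub>C \<rho> x_a (\<rho> x_a v) = 2 *\<^sub>C (- \<rho> x_2a v)"
    by (simp add: scaleC_double)
  then have "\<rho> x_a (\<rho> x_a v) = - \<rho> x_2a v" by (metis cv.scale_left_imp_eq zero_neq_numeral)
  then show ?thesis by simp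
qed

lemma rep_m2a: "\<rho> x_m2a v = \<rho> x_ma (\<rho> x_ma v)"
proof -
  have "\<rho> x_ma (\<rho> x_ma v) = 2 *\<^sub>C \<rho> x_m2a v - \<rho> x_ma (\<rho> x_ma v)"
    using rep_bracket[of 1 x_ma 1 x_ma v] by (simp add: osp_bracket_basis koszul_def rep_scale_arg)
  then have "2 *\<^sub>C (\<rho> x_ma (\<rho> x_ma v) - \<rho> x_m2a v) = 0"
    by (simp add: scaleC_double cv.scale_right_diff_distrib eq_diff_eq)
  then show ?thesis by simp
qed

lemma rep_expansion:
  "\<rho> x v = x $ X_m2 *\<^sub>C \<rho> x_ma (\<rho> x_ma v) + x $ X_m1 *\<^sub>C \<rho> x_ma v + x $ X_h *\<^sub>C \<rho> x_h v
    + x $ X_p1 *\<^sub>C \<rho> x_a v - x $ X_p2 *\<^sub>C \<rho> x_a (\<rho> x_a v)"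
proof -
  have "\<rho> x v = \<rho> (x $ X_m2 *s x_m2a + x $ X_m1 *s x_ma + x $ X_h *s x_h
      + x $ X_p1 *s x_a + x $ X_p2 *s x_2a) v"
    by (simp only: osp_basis_expansion[symmetric])
  also have "\<dots> = x $ X_m2 *\<^sub>C \<rho> x_ma (\<rho> x_ma v) + x $ X_m1 *\<^sub>C \<rho> x_ma v
      + x $ X_h *\<^sub>C \<rho> x_h v + x $ X_p1 *\<^sub>C \<rho> x_a v - x $ X_p2 *\<^sub>C \<rho> x_a (\<rho> x_a v)"
    by (simp add: rep_add_arg rep_scale_arg rep_2a rep_m2a)
  finally show ?thesis .
qed

end

section \<open>Singular vectors\<close>

text \<open>Such a vector is killed by all of \<open>n\<^sub>+\<close>, because \<open>x\<^bsub>2\<alpha>\<^esub>\<close> acts as \<open>-x\<^sub>\<alpha>\<^sup>2\<close> in every representation.\<close>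

definition singular_vector :: "(osp12 \<Rightarrow> 'v::cvector \<Rightarrow> 'v) \<Rightarrow> complex \<Rightarrow> 'v \<Rightarrow> bool"
  where "singular_vector \<rho> \<mu> w \<longleftrightarrow> \<rho> x_h w = \<mu> *\<^sub>C w \<and> \<rho> x_a w = 0"

text \<open>The scalar in \<open>e f\<^sup>k w = c\<^sub>k f\<^bsup>k-1\<^esup> w\<close> for singular \<open>w\<close> of weight \<open>\<mu>\<close>.  The parity of \<open>k\<close> enters
  because \<open>e\<close> and \<open>f\<close> anticommute up to \<open>h\<close>.\<close>

definition ladder :: "complex \<Rightarrow> nat \<Rightarrow> complex"
  where "ladder \<mu> k = of_nat (k div 2) + (if odd k then \<mu> else 0)"

lemma ladder_0: "ladder \<mu> 0 = 0"
  by (simp add: ladder_def)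

lemma ladder_Suc: "ladder \<mu> (Suc k) = \<mu> + of_nat k - ladder \<mu> k"
  by (cases "even k") (auto simp: ladder_def elim!: evenE oddE)

context osp_rep
begin

lemma weight_lowering_pow:
  assumes "\<rho> x_h w = \<mu> *\<^sub>C w"
  shows "\<rho> x_h ((\<rho> x_ma ^^ k) w) = (\<mu> + of_nat k) *\<^sub>C (\<rho> x_ma ^^ k) w"
  using assms by (induction k) (simp_all add: rep_h_ma L.scale L.add scaleC_add_left scaleC_one add_ac)

text \<open>Moving \<open>e\<close> past one \<open>f\<close> contributes the weight of the vector and changes the sign of the
  rest; that is the recursion \<open>ladder_Suc\<close>.  For \<open>k = 0\<close> the truncated exponent is harmless since the
  scalar vanishes.\<close>

lemma raising_lowering_pow:
  assumes "singular_vector \<rho> \<mu> w"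
  shows "\<rho> x_a ((\<rho> x_ma ^^ k) w) = ladder \<mu> k *\<^sub>C (\<rho> x_ma ^^ (k - 1)) w"
proof (induction k)
  case 0
  then show ?case using assms by (simp add: singular_vector_def ladder_0)
next
  case (Suc k)
  have "ladder \<mu> k *\<^sub>C \<rho> x_ma ((\<rho> x_ma ^^ (k - 1)) w) = ladder \<mu> k *\<^sub>C (\<rho> x_ma ^^ k) w"
  proof (cases k)
    case 0
    show ?thesis unfolding 0 ladder_0 by simp
  next
    case (Suc m)
    show ?thesis unfolding Suc by simp
  qed
  moreover have "\<rho> x_h ((\<rho> x_ma ^^ k) w) = (\<mu> + of_nat k) *\<^sub>C (\<rho> x_ma ^^ k) w"
    using assms by (simp add: singular_vector_def weight_lowering_pow)
  ultimately show ?case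
    by (simp add: rep_a_ma Suc L.scale ladder_Suc cv.scale_left_diff_distrib)
qed

lemma homogeneous_rep:
  assumes "osp_part p x = x" "homogeneous q v"
  shows "homogeneous (p + q) (\<rho> x v)"
  using hpart_rep[OF assms(1), of q v] assms(2) by (simp add: homogeneous_def)

lemma homogeneous_lowering_pow:
  assumes "homogeneous p w"
  shows "homogeneous (p + of_nat k) ((\<rho> x_ma ^^ k) w)"
proof (induction k)
  case (Suc k)
  have "(1 :: bit) + (p + of_nat k) = p + of_nat (Suc k)" by simp
  then show ?case using homogeneous_rep[OF osp_part_basis(2) Suc] by simp
qed (use assms in \<open>cases p; simp\<close>)

text \<open>The submodule \<open>U(n\<^sub>-) w\<close> in a form suited to induction; see \<open>U_submodule_n_minus\<close>.\<close>

definition lowered_span :: "'v \<Rightarrow> 'v set"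
  where "lowered_span w = cv.span (range (\<lambda>k. (\<rho> x_ma ^^ k) w))"

lemma subspace_lowered_span: "cv.subspace (lowered_span w)"
  by (simp add: lowered_span_def)

lemma lowering_pow_in: "(\<rho> x_ma ^^ k) w \<in> lowered_span w"
  unfolding lowered_span_def by (rule cv.span_base) auto

lemma self_in_lowered_span: "w \<in> lowered_span w"
  using lowering_pow_in[of 0 w] by simp

lemma lowered_span_least:
  assumes U: "cv.subspace U" "\<And>u. u \<in> U \<Longrightarrow> \<rho> x_ma u \<in> U" and "w \<in> U"
  shows "lowered_span w \<subseteq> U"
proof -
  have "(\<rho> x_ma ^^ k) w \<in> U" for k
    by (induction k) (simp_all add: assms)
  then show ?thesis unfolding lowered_span_def using U by (intro cv.span_minimal) auto
qed

lemma lowered_span_closed: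
  assumes "clinear F" "\<And>k. F ((\<rho> x_ma ^^ k) w) \<in> lowered_span w" "u \<in> lowered_span w"
  shows "F u \<in> lowered_span w"
proof -
  have "F u \<in> cv.span (range (\<lambda>k. (\<rho> x_ma ^^ k) w))"
    by (rule clinear_span_closed[OF assms(1), where B = "range (\<lambda>k. (\<rho> x_ma ^^ k) w)"])
      (use assms(2,3) in \<open>auto simp: lowered_span_def\<close>)
  then show ?thesis by (simp add: lowered_span_def)
qed

lemma lowering_closed:
  assumes "u \<in> lowered_span w" shows "\<rho> x_ma u \<in> lowered_span w"
proof -
  have "\<rho> x_ma ((\<rho> x_ma ^^ k) w) \<in> lowered_span w" for k
    using lowering_pow_in[of "Suc k" w] by simp
  then show ?thesis
    by (rule lowered_span_closed[OF clinear_rep]) (use assms in auto)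
qed

text \<open>Holds because \<open>x\<^bsub>-2\<alpha>\<^esub>\<close> acts as the square of \<open>x\<^bsub>-\<alpha>\<^esub>\<close>.\<close>

lemma U_submodule_n_minus: "U_submodule \<rho> n_minus w = lowered_span w"
proof
  have "A w \<in> lowered_span w" if "A \<in> enveloping_ops \<rho> n_minus" for A
    using that
  proof induction
    case (mult y A)
    then have "\<rho> y (A w) = y $ X_m2 *\<^sub>C \<rho> x_ma (\<rho> x_ma (A w)) + y $ X_m1 *\<^sub>C \<rho> x_ma (A w)"
      by (subst rep_expansion) (simp add: n_minus_def)
    with mult show ?case
      by (simp add: lowering_closed cv.subspace_add cv.subspace_scale subspace_lowered_span)
  qed (simp_all add: self_in_lowered_span cv.subspace_add cv.subspace_scale subspace_lowered_span)
  then show "U_submodule \<rho> n_minus w \<subseteq> lowered_span w"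
    by (auto simp: U_submodule_def)
  show "lowered_span w \<subseteq> U_submodule \<rho> n_minus w"
  proof (rule lowered_span_least)
    have zero: "(\<lambda>w. 0 *\<^sub>C w) \<in> enveloping_ops \<rho> n_minus"
      by (rule enveloping_ops.scale) (rule enveloping_ops.one)
    show "cv.subspace (U_submodule \<rho> n_minus w)"
    proof (rule cv.subspaceI)
      show "0 \<in> U_submodule \<rho> n_minus w"
        unfolding U_submodule_def by (rule image_eqI[OF _ zero]) simp
      show "x + y \<in> U_submodule \<rho> n_minus w"
        if "x \<in> U_submodule \<rho> n_minus w" "y \<in> U_submodule \<rho> n_minus w" for x y
        using that unfolding U_submodule_def by (auto intro: image_eqI[OF _ enveloping_ops.add])
      show "c *\<^sub>C x \<in> U_submodule \<rho> n_minus w" if "x \<in> U_submodule \<rho> n_minus w" for c x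
        using that unfolding U_submodule_def by (auto intro: image_eqI[OF _ enveloping_ops.scale])
    qed
    have "x_ma \<in> n_minus" by (simp add: n_minus_def x_ma_def axis_def)
    then show "\<rho> x_ma u \<in> U_submodule \<rho> n_minus w" if "u \<in> U_submodule \<rho> n_minus w" for u
      using that unfolding U_submodule_def by (auto intro: image_eqI[OF _ enveloping_ops.mult])
    show "w \<in> U_submodule \<rho> n_minus w"
      unfolding U_submodule_def by (rule image_eqI[OF _ enveloping_ops.one]) simp
  qed
qed

text \<open>Homogeneity of \<open>w\<close> is what makes the span graded: each \<open>f\<^sup>k w\<close> is then homogeneous as
  well.\<close>

lemma subrep_lowered_span:
  assumes w: "singular_vector \<rho> \<mu> w" and hom: "homogeneous p w"
  shows "subrep \<rho> (lowered_span w)"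
  unfolding subrep_def
proof (intro conjI allI ballI)
  note sub = cv.subspace_add[OF subspace_lowered_span] cv.subspace_scale[OF subspace_lowered_span]
    cv.subspace_diff[OF subspace_lowered_span]
  show "super_rep \<rho>" by (rule rep)
  show "cv.subspace (lowered_span w)" by (rule subspace_lowered_span)
  show "hpart q u \<in> lowered_span w" if "u \<in> lowered_span w" for q u
  proof -
    have "hpart q ((\<rho> x_ma ^^ k) w) \<in> lowered_span w" for k
      using homogeneous_other[OF homogeneous_lowering_pow[OF hom], of q k] lowering_pow_in
        cv.subspace_0[OF subspace_lowered_span] by simp
    then show ?thesis
      by (rule lowered_span_closed[OF clinear_hpart]) (use that in auto)
  qed
  fix x u assume u: "u \<in> lowered_span w"
  have "\<rho> x_h ((\<rho> x_ma ^^ k) w) \<in> lowered_span w" for k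
    using weight_lowering_pow[of w \<mu>] w by (simp add: singular_vector_def sub lowering_pow_in)
  then have h: "\<rho> x_h u \<in> lowered_span w" 
    by (rule lowered_span_closed[OF clinear_rep]) (use u in auto)
  have "\<rho> x_a ((\<rho> x_ma ^^ k) w) \<in> lowered_span w" for k
    using raising_lowering_pow[OF w] by (simp add: sub lowering_pow_in)
  then have a: "\<rho> x_a u \<in> lowered_span w" if "u \<in> lowered_span w" for u
    by (rule lowered_span_closed[OF clinear_rep]) (use that in auto)
  show "\<rho> x u \<in> lowered_span w"
    by (subst rep_expansion) (intro sub h a lowering_closed u)
qed

text \<open>Applying \<open>e\<close> to \<open>\<Sum> c\<^sub>k f\<^sup>k w\<close> gives vectors of distinct weights, so every summand with \<open>k \<ge> 1\<close> must
  vanish on its own when the ladder scalars are nonzero.\<close>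

lemma lowered_span_kernel:
  assumes w: "singular_vector \<rho> \<mu> w" and ladder: "\<And>k. ladder \<mu> (Suc k) \<noteq> 0"
    and u: "u \<in> lowered_span w" and "\<rho> x_a u = 0"
  obtains c where "u = c *\<^sub>C w"
proof -
  obtain n c where u: "u = (\<Sum>k<n. c k *\<^sub>C (\<rho> x_ma ^^ k) w)"
    using u unfolding lowered_span_def by (rule span_range_sum)
  \<comment> \<open>The summand for \<open>k = 0\<close> is zero, hence an eigenvector for the formal weight \<open>\<mu> - 1\<close> too.\<close>
  let ?y = "\<lambda>k. c k *\<^sub>C ladder \<mu> k *\<^sub>C (\<rho> x_ma ^^ (k - 1)) w"
  have y0: "?y k = 0" if "k < n" for k
  proof (rule eigenvector_sum_eq_0[where T = "\<rho> x_h" and y = ?y and k = k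
        and \<mu> = "\<lambda>k. \<mu> + of_nat k - 1" and S = "{..<n}"])
    fix k
    have "\<rho> x_h ((\<rho> x_ma ^^ (k - 1)) w) = (\<mu> + of_nat k - 1) *\<^sub>C (\<rho> x_ma ^^ (k - 1)) w"
      if "k > 0"
      using weight_lowering_pow[of w \<mu> "k - 1"] w that by (simp add: singular_vector_def of_nat_diff algebra_simps)
    then show "\<rho> x_h (?y k) = (\<mu> + of_nat k - 1) *\<^sub>C ?y k"
      by (cases "k = 0") (simp_all add: ladder_0 L.scale mult_ac)
    show "(\<Sum>k<n. ?y k) = 0"
      using \<open>\<rho> x_a u = 0\<close> by (simp add: u L.sum L.scale raising_lowering_pow[OF w])
  qed (use that in \<open>auto simp: inj_on_def clinear_rep\<close>)
  have z: "c k *\<^sub>C (\<rho> x_ma ^^ k) w = 0" if k: "k < n" "k \<noteq> 0" for k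
  proof -
    obtain m where m: "k = Suc m" using k by (cases k) auto
    have "c k *\<^sub>C (\<rho> x_ma ^^ m) w = 0"
      using y0[OF k(1)] ladder[of m] by (simp add: m)
    then have "\<rho> x_ma (c k *\<^sub>C (\<rho> x_ma ^^ m) w) = 0" by (metis L.zero)
    then show ?thesis by (simp add: m L.scale)
  qed
  have "u = (\<Sum>k<n. if k = 0 then c 0 *\<^sub>C w else 0)"
    unfolding u by (intro sum.cong) (auto simp: z)
  also have "\<dots> = (if n = 0 then 0 else c 0) *\<^sub>C w"
    by (subst sum.delta) auto
  finally show thesis by (rule that)
qed

lemma raising_pow_zero [simp]: "(\<rho> x_a ^^ n) 0 = 0"
  by (induction n) (simp_all add: L.zero)

lemma raising_pow_add: "(\<rho> x_a ^^ n) (u + v) = (\<rho> x_a ^^ n) u + (\<rho> x_a ^^ n) v"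
  by (induction n) (simp_all add: L.add)

lemma raising_pow_scale: "(\<rho> x_a ^^ n) (c *\<^sub>C u) = c *\<^sub>C (\<rho> x_a ^^ n) u"
  by (induction n) (simp_all add: L.scale)

lemma raising_nilpotent_subspace: "cv.subspace {u. \<exists>n. (\<rho> x_a ^^ n) u = 0}"
proof -
  have mono: "(\<rho> x_a ^^ (m + n)) u = 0" if "(\<rho> x_a ^^ n) u = 0" for m n u
    using that by (simp add: funpow_add)
  show ?thesis
  proof (rule cv.subspaceI; clarsimp)
    show "\<exists>n. (\<rho> x_a ^^ n) (u + v) = 0" if "(\<rho> x_a ^^ m) u = 0" "(\<rho> x_a ^^ n) v = 0" for u v m n
      using mono[OF that(1), of n] mono[OF that(2), of m]
      by (intro exI[of _ "m + n"]) (simp add: raising_pow_add add.commute)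
    show "\<exists>n. (\<rho> x_a ^^ n) (c *\<^sub>C u) = 0" if "(\<rho> x_a ^^ n) u = 0" for c u n
      using that by (intro exI[of _ n]) (simp add: raising_pow_scale)
  qed
qed

lemma raising_nilpotent:
  assumes w: "singular_vector \<rho> \<mu> w" and u: "u \<in> lowered_span w"
  obtains n where "(\<rho> x_a ^^ n) u = 0"
proof -
  have "(\<rho> x_a ^^ Suc k) ((\<rho> x_ma ^^ k) w) = 0" for k
  proof (induction k)
    case 0
    show ?case using w by (simp add: singular_vector_def)
  next
    case (Suc k)
    show ?case
      using Suc raising_lowering_pow[OF w, of "Suc k"]
      by (subst funpow_Suc_right) (simp add: raising_pow_scale L.scale)
  qed
  then have "lowered_span w \<subseteq> {u. \<exists>n. (\<rho> x_a ^^ n) u = 0}"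
    unfolding lowered_span_def by (intro cv.span_minimal raising_nilpotent_subspace) blast
  with u that show thesis by blast
qed

text \<open>Raise a nonzero vector of \<open>U\<close> until just before it dies: the result is a nonzero multiple of
  \<open>w\<close> by \<open>lowered_span_kernel\<close>.\<close>

lemma singular_in_submodule:
  assumes w: "singular_vector \<rho> \<mu> w" and ladder: "\<And>k. ladder \<mu> (Suc k) \<noteq> 0"
    and U: "subrep \<rho> U" "U \<subseteq> lowered_span w" and u: "u \<in> U" "u \<noteq> 0"
  shows "w \<in> U"
proof -
  obtain n where "(\<rho> x_a ^^ n) u = 0"
    using raising_nilpotent[OF w] U u by blast
  then show ?thesis using u
  proof (induction n arbitrary: u)
    case (Suc n)
    have a: "\<rho> x_a u \<in> U" using U Suc.prems by (simp add: subrep_def)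
    show ?case
    proof (cases "\<rho> x_a u = 0")
      case True
      then obtain c where c: "u = c *\<^sub>C w"
        using lowered_span_kernel[OF w ladder] U Suc.prems by blast
      have "inverse c *\<^sub>C u \<in> U" using U Suc.prems by (simp add: subrep_def cv.subspace_scale)
      then show ?thesis using c Suc.prems by (simp add: scaleC_one)
    next
      case False
      have "(\<rho> x_a ^^ n) (\<rho> x_a u) = 0"
        using Suc.prems(1) by (subst (asm) funpow_Suc_right) simp
      then show ?thesis using Suc.IH[OF _ a False] by simp
    qed
  qed simp
qed

lemma irreducible_lowered_span:
  assumes w: "singular_vector \<rho> \<mu> w" and "homogeneous p w" and "w \<noteq> 0"
    and ladder: "\<And>k. ladder \<mu> (Suc k) \<noteq> 0"
  shows "irreducible_subrep \<rho> (lowered_span w)"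
  unfolding irreducible_subrep_def
proof (intro conjI allI impI)
  show "subrep \<rho> (lowered_span w)" using assms(1,2) by (rule subrep_lowered_span)
  show "lowered_span w \<noteq> {0}" using self_in_lowered_span[of w] \<open>w \<noteq> 0\<close> by auto
  fix U assume U: "U \<subseteq> lowered_span w" "subrep \<rho> U"
  show "U = {0} \<or> U = lowered_span w"
  proof (cases "U = {0}")
    case False
    moreover have "0 \<in> U" using U by (simp add: subrep_def cv.subspace_0)
    ultimately obtain u where "u \<in> U" "u \<noteq> 0" by blast
    then have "w \<in> U" using singular_in_submodule[OF w ladder U(2,1)] by blast
    then have "lowered_span w \<subseteq> U"
      using U by (intro lowered_span_least) (auto simp: subrep_def)
    with U show ?thesis by blast
  qed simp
qed

text \<open>A vector of any other weight could be added to the string of the \<open>f\<^sup>k w\<close> as an independent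
  member.\<close>

lemma weights_of_lowered_span:
  assumes w: "\<rho> x_h w = \<mu> *\<^sub>C w" and y: "y \<in> lowered_span w" "y \<noteq> 0" "\<rho> x_h y = \<nu> *\<^sub>C y"
  obtains k where "\<nu> = \<mu> + of_nat k"
proof (rule ccontr)
  assume "\<not> thesis"
  with that have ne: "\<nu> \<noteq> \<mu> + of_nat k" for k by blast
  obtain n c where n: "y = (\<Sum>k<n. c k *\<^sub>C (\<rho> x_ma ^^ k) w)"
    using y(1) unfolding lowered_span_def by (rule span_range_sum)
  \<comment> \<open>Index \<open>n\<close> carries \<open>- y\<close>, so that the whole family sums to zero.\<close>
  have "(if n < n then c n *\<^sub>C (\<rho> x_ma ^^ n) w else - y) = 0"
  proof (rule eigenvector_sum_eq_0[where T = "\<rho> x_h" and S = "{..n}"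
        and y = "\<lambda>k. if k < n then c k *\<^sub>C (\<rho> x_ma ^^ k) w else - y" and k = n
        and \<mu> = "\<lambda>k. if k < n then \<mu> + of_nat k else \<nu>"])
    show "inj_on (\<lambda>k. if k < n then \<mu> + of_nat k else \<nu>) {..n}"
      using ne ne[symmetric] by (auto simp: inj_on_def)
    show "(\<Sum>k\<le>n. if k < n then c k *\<^sub>C (\<rho> x_ma ^^ k) w else - y) = 0"
      using n by (simp add: lessThan_Suc_atMost[symmetric])
    show "\<rho> x_h (if k < n then c k *\<^sub>C (\<rho> x_ma ^^ k) w else - y)
        = (if k < n then \<mu> + of_nat k else \<nu>) *\<^sub>C (if k < n then c k *\<^sub>C (\<rho> x_ma ^^ k) w else - y)" for k
      by (simp add: L.scale L.neg weight_lowering_pow[OF w] y(3) mult.commute)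
  qed (simp_all add: clinear_rep)
  with y show False by simp
qed

end

section \<open>Finite-dimensional highest weight modules\<close>

context osp_rep
begin

text \<open>The highest weight vector is not assumed homogeneous, but one of its parts \<open>v'\<close> is a nonzero
  singular vector of the same weight and generates the irreducible module.  The weight space of \<open>v'\<close>
  in \<open>U(n\<^sub>-) v'\<close> is a line, so \<open>v\<close> is a multiple of \<open>v'\<close>.\<close>

lemma highest_weight_homogeneous:
  assumes irr: "highest_weight_irrep \<rho> \<xi> v"
  obtains p where "homogeneous p v" "lowered_span v = UNIV"
proof -
  have v: "v \<noteq> 0" "\<rho> x_h v = \<xi> *\<^sub>C v" "\<rho> x_a v = 0"
    and simple: "\<And>U. subrep \<rho> U \<Longrightarrow> U = {0} \<or> U = UNIV"
    using irr by (auto simp: highest_weight_irrep_def irreducible_subrep_def)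
  obtain p where p: "hpart p v \<noteq> 0"
    using hpart_sum[of v] \<open>v \<noteq> 0\<close> by fastforce
  have sing: "singular_vector \<rho> \<xi> (hpart p v)"
    using hpart_rep[of 0 x_h p v] hpart_rep[of 1 x_a p v]
    by (cases p) (simp_all add: singular_vector_def v hpart_scaleC)
  have span: "lowered_span u = UNIV" if "singular_vector \<rho> \<xi> u" "homogeneous p u" "u \<noteq> 0" for u
    using simple[OF subrep_lowered_span[OF that(1,2)]] self_in_lowered_span[of u] that(3) by auto
  then have "v \<in> lowered_span (hpart p v)"
    using sing p homogeneous_hpart by blast
  then obtain n c where c: "v = (\<Sum>k<n. c k *\<^sub>C (\<rho> x_ma ^^ k) (hpart p v))"
    unfolding lowered_span_def by (rule span_range_sum)
  \<comment> \<open>Absorbing \<open>v\<close> into the term \<open>k = 0\<close> keeps the weights of the family distinct.\<close>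
  let ?y = "\<lambda>k. c k *\<^sub>C (\<rho> x_ma ^^ k) (hpart p v) - (if k = 0 then v else 0)"
  have "n \<noteq> 0" by (metis c \<open>v \<noteq> 0\<close> lessThan_0 sum.empty)
  have "?y 0 = 0"
  proof (rule eigenvector_sum_eq_0[where T = "\<rho> x_h" and \<mu> = "\<lambda>k. \<xi> + of_nat k" and S = "{..<n}"
        and y = ?y and k = 0])
    show "(\<Sum>k<n. ?y k) = 0"
      using \<open>n \<noteq> 0\<close> by (simp add: sum_subtractf c[symmetric])
    show "\<rho> x_h (?y k) = (\<xi> + of_nat k) *\<^sub>C ?y k" for k
      using sing weight_lowering_pow[of "hpart p v" \<xi> k] v(2)
      by (simp add: L.diff L.scale singular_vector_def cv.scale_right_diff_distrib mult.commute)
  qed (use \<open>n \<noteq> 0\<close> in \<open>auto simp: inj_on_def clinear_rep\<close>)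
  then have "v = c 0 *\<^sub>C hpart p v" by simp
  then have "homogeneous p v"
    unfolding homogeneous_def by (metis hpart_hpart hpart_scaleC)
  moreover from this have "lowered_span v = UNIV"
    using span v by (simp add: singular_vector_def)
  ultimately show thesis by (rule that)
qed

text \<open>The nonzero \<open>f\<^sup>k w\<close> have distinct weights, so they form a basis and their number is the
  dimension; the exponents concerned form an initial segment.  By convention infinite-dimensional spaces have
  dimension 0, so positivity of the dimension says that it is finite.\<close>

lemma lowering_pow_eq_0_iff:
  assumes w: "\<rho> x_h w = \<mu> *\<^sub>C w" and span: "lowered_span w = UNIV"
    and dim: "cv.dim (UNIV :: 'v set) > 0"
  shows "(\<rho> x_ma ^^ k) w = 0 \<longleftrightarrow> cv.dim (UNIV :: 'v set) \<le> k"
proof -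
  let ?g = "\<lambda>k. (\<rho> x_ma ^^ k) w" and ?K = "{k. (\<rho> x_ma ^^ k) w \<noteq> 0}"
  have wt: "\<rho> x_h (?g k) = (\<mu> + of_nat k) *\<^sub>C ?g k" for k
    using w by (rule weight_lowering_pow)
  have indep0: "c k *\<^sub>C ?g k = 0" if "finite S" "(\<Sum>k\<in>S. c k *\<^sub>C ?g k) = 0" "k \<in> S" for S c k
    by (rule eigenvector_sum_eq_0[where T = "\<rho> x_h" and \<mu> = "\<lambda>k. \<mu> + of_nat k" and S = S
        and y = "\<lambda>k. c k *\<^sub>C ?g k"]) (use that in \<open>auto simp: inj_on_def clinear_rep L.scale wt mult.commute\<close>)
  have inj: "inj_on ?g ?K"
  proof (rule inj_onI, rule ccontr)
    fix i j assume ij: "i \<in> ?K" "j \<in> ?K" "?g i = ?g j" "i \<noteq> j"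
    have "(if i = i then 1 else -1) *\<^sub>C ?g i = 0"
      by (rule indep0[where S = "{i, j}" and c = "\<lambda>k. if k = i then 1 else -1"]) (use ij in auto)
    with ij show False by (simp add: scaleC_one)
  qed
  have "cv.independent (?g ` ?K)"
    unfolding cv.dependent_explicit
  proof clarify
    fix t u y assume t: "finite t" "t \<subseteq> ?g ` ?K" "(\<Sum>y\<in>t. u y *\<^sub>C y) = 0" "y \<in> t" "u y \<noteq> 0"
    then obtain S where S: "S \<subseteq> ?K" "t = ?g ` S" by (auto simp: subset_image_iff)
    have injS: "inj_on ?g S" using inj S(1) by (rule inj_on_subset)
    have fin: "finite S" using t(1) S(2) injS by (simp add: finite_image_iff)
    have sum: "(\<Sum>k\<in>S. u (?g k) *\<^sub>C ?g k) = 0"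
      using t(3) by (simp add: S(2) sum.reindex[OF injS])
    obtain k where k: "k \<in> S" "y = ?g k" using t(4) S by blast
    have "u (?g k) *\<^sub>C ?g k = 0"
      by (rule indep0[where S = S and c = "\<lambda>k. u (?g k)"]) (use fin sum k in auto)
    then show False using t(5) k S(1) by auto
  qed
  moreover have "cv.span (?g ` ?K) = cv.span UNIV"
  proof -
    have "?g k \<in> cv.span (?g ` ?K)" for k
      by (cases "?g k = 0") (simp_all add: cv.span_zero cv.span_base)
    then have "lowered_span w \<subseteq> cv.span (?g ` ?K)"
      unfolding lowered_span_def by (intro cv.span_minimal) auto
    then show ?thesis using span by auto
  qed
  ultimately have "cv.dim (UNIV :: 'v set) = card (?g ` ?K)"
    by (intro cv.dim_eq_card) auto
  then have card: "cv.dim (UNIV :: 'v set) = card ?K"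
    by (simp add: card_image[OF inj])
  have down: "i \<in> ?K" if "j \<in> ?K" "i \<le> j" for i j
  proof -
    have "(\<rho> x_ma ^^ (j - i)) (?g i) = ?g j"
      using that by (simp add: funpow_add[symmetric, THEN fun_cong, simplified])
    moreover have "(\<rho> x_ma ^^ n) 0 = 0" for n by (induction n) (simp_all add: L.zero)
    ultimately show ?thesis using that by auto
  qed
  have fin: "finite ?K" using dim card card_gt_0_iff by metis
  have "k \<in> ?K \<longleftrightarrow> k < card ?K"
  proof
    assume "k \<in> ?K"
    then have "{..k} \<subseteq> ?K" using down by blast
    then show "k < card ?K" using card_mono[OF fin, of "{..k}"] by simp
  next
    assume k: "k < card ?K"
    show "k \<in> ?K"
    proof (rule ccontr)
      assume "k \<notin> ?K"
      then have "?K \<subseteq> {..<k}" using down by (meson lessThan_iff not_le_imp_less subsetI)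
      then show False using card_mono[of "{..<k}" ?K] k by simp
    qed
  qed
  then show ?thesis unfolding card by (auto simp: not_less)
qed

end

section \<open>Tensor products of representations\<close>

lemma hpart_tensor_homogeneous:
  assumes "homogeneous q u" shows "hpart r (u \<otimes> w) = u \<otimes> hpart (r + q) w"
  using homogeneous_other[OF assms, of 0] homogeneous_other[OF assms, of 1]
  by (cases q) (simp_all add: hpart_tensor_prod)

text \<open>Under the super sign rule operators are given by a simple formula only on \<open>u \<otimes> v\<close> with
  homogeneous \<open>u\<close>.\<close>

lemma clinear_tensor_homogeneous_eqI:
  fixes F G :: "('a::super_vector, 'b::super_vector) tensor \<Rightarrow> 'c::cvector"
  assumes "clinear F" "clinear G"
    and "\<And>p u v. homogeneous p u \<Longrightarrow> F (u \<otimes> v) = G (u \<otimes> v)"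
  shows "F t = G t"
proof (rule clinear_tensor_eqI[OF assms(1,2)])
  fix u :: 'a and v :: 'b
  have "u \<otimes> v = hpart 0 u \<otimes> v + hpart 1 u \<otimes> v"
    by (simp add: tensor_prod_add_left[symmetric] hpart_sum)
  then show "F (u \<otimes> v) = G (u \<otimes> v)"
    using assms(3)[OF homogeneous_hpart]
    by (simp add: clinear_add[OF assms(1)] clinear_add[OF assms(2)])
qed

lemma koszul_square: "koszul p q * koszul p q = 1"
  by (simp add: koszul_def)

lemma koszul_add: "koszul (p + q) r = koszul p r * koszul q r" "koszul r (p + q) = koszul r p * koszul r q"
  by (cases p; cases q; simp add: koszul_def)+

lemma koszul_commute: "koszul p q = koszul q p"
  by (auto simp: koszul_def)

locale osp_tensor = P: osp_rep \<pi> + Q: osp_rep \<sigma>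
  for \<pi> :: "osp12 \<Rightarrow> 'u::super_vector \<Rightarrow> 'u" and \<sigma> :: "osp12 \<Rightarrow> 'v::super_vector \<Rightarrow> 'v"
begin

lemma clinear_act_left: "clinear (act_left \<pi> x)"
  unfolding act_left_def by (intro clinear_super_tensor_op P.clinear_rep clinear_id)

lemma clinear_act_right: "clinear (act_right \<sigma> x)"
  unfolding act_right_def by (intro clinear_plus clinear_super_tensor_op Q.clinear_rep clinear_id)

lemma act_left_prod:
  assumes "homogeneous p u" shows "act_left \<pi> x (u \<otimes> w) = \<pi> x u \<otimes> w"
  unfolding act_left_def
  by (subst super_tensor_op_prod[OF P.clinear_rep clinear_id assms]) (simp add: koszul_def scaleC_one)

lemma act_right_prod:
  assumes u: "homogeneous p u" and x: "osp_part q x = x"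
  shows "act_right \<sigma> x (u \<otimes> w) = koszul q p *\<^sub>C (u \<otimes> \<sigma> x w)"
  unfolding act_right_def super_tensor_op_prod[OF clinear_id Q.clinear_rep u]
  using osp_part_fixed_other[OF x, of 0] osp_part_fixed_other[OF x, of 1]
  by (cases q) simp_all

lemma act_left_add: "act_left \<pi> (x + y) t = act_left \<pi> x t + act_left \<pi> y t"
  for t :: "('u, 'v) tensor"
proof (rule clinear_tensor_homogeneous_eqI[where F = "act_left \<pi> (x + y)"
      and G = "\<lambda>t. act_left \<pi> x t + act_left \<pi> y t"])
  fix p u and w :: 'v assume "homogeneous p (u :: 'u)"
  then show "act_left \<pi> (x + y) (u \<otimes> w) = act_left \<pi> x (u \<otimes> w) + act_left \<pi> y (u \<otimes> w)"
    by (simp add: act_left_prod P.rep_add_arg tensor_prod_simps)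
qed (intro clinear_plus clinear_act_left)+

lemma act_left_scale: "act_left \<pi> (c *s x) t = c *\<^sub>C act_left \<pi> x t"
  for t :: "('u, 'v) tensor"
proof (rule clinear_tensor_homogeneous_eqI[where F = "act_left \<pi> (c *s x)"
      and G = "\<lambda>t. c *\<^sub>C act_left \<pi> x t"])
  fix p u and w :: 'v assume "homogeneous p (u :: 'u)"
  then show "act_left \<pi> (c *s x) (u \<otimes> w) = c *\<^sub>C act_left \<pi> x (u \<otimes> w)"
    by (simp add: act_left_prod P.rep_scale_arg tensor_prod_simps)
qed (intro clinear_scaled clinear_act_left)+

lemma act_right_add: "act_right \<sigma> (x + y) t = act_right \<sigma> x t + act_right \<sigma> y t"
  for t :: "('u, 'v) tensor"
proof (rule clinear_tensor_homogeneous_eqI[where F = "act_right \<sigma> (x + y)"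
      and G = "\<lambda>t. act_right \<sigma> x t + act_right \<sigma> y t"])
  fix p u and w :: 'v assume "homogeneous p (u :: 'u)"
  then show "act_right \<sigma> (x + y) (u \<otimes> w) = act_right \<sigma> x (u \<otimes> w) + act_right \<sigma> y (u \<otimes> w)"
    by (simp add: act_right_def super_tensor_op_prod[OF clinear_id Q.clinear_rep]
        osp_part_add Q.rep_add_arg tensor_prod_simps scaleC_add_right)
qed (intro clinear_plus clinear_act_right)+

lemma act_right_scale: "act_right \<sigma> (c *s x) t = c *\<^sub>C act_right \<sigma> x t"
  for t :: "('u, 'v) tensor"
proof (rule clinear_tensor_homogeneous_eqI[where F = "act_right \<sigma> (c *s x)"
      and G = "\<lambda>t. c *\<^sub>C act_right \<sigma> x t"])
  fix p u and w :: 'v assume "homogeneous p (u :: 'u)"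
  then show "act_right \<sigma> (c *s x) (u \<otimes> w) = c *\<^sub>C act_right \<sigma> x (u \<otimes> w)"
    by (simp add: act_right_def super_tensor_op_prod[OF clinear_id Q.clinear_rep]
        osp_part_scale Q.rep_scale_arg tensor_prod_simps scaleC_add_right scaleC_scaleC mult.commute)
qed (intro clinear_scaled clinear_act_right)+

lemma hpart_act_left:
  fixes t :: "('u, 'v) tensor"
  assumes x: "osp_part p x = x"
  shows "hpart (p + q) (act_left \<pi> x t) = act_left \<pi> x (hpart q t)"
proof (rule clinear_tensor_homogeneous_eqI[where F = "\<lambda>t. hpart (p + q) (act_left \<pi> x t)"
      and G = "\<lambda>t. act_left \<pi> x (hpart q t)"])
  fix r u and w :: 'v assume u: "homogeneous r (u :: 'u)"
  have "p + q + (p + r) = q + r" by (cases p; cases q; cases r) simp_all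
  then show "hpart (p + q) (act_left \<pi> x (u \<otimes> w)) = act_left \<pi> x (hpart q (u \<otimes> w))"
    by (simp only: act_left_prod[OF u] hpart_tensor_homogeneous[OF u]
        hpart_tensor_homogeneous[OF P.homogeneous_rep[OF x u]])
qed (intro clinear_compose[OF clinear_hpart] clinear_compose[OF clinear_act_left] clinear_hpart clinear_act_left)+

lemma hpart_act_right:
  fixes t :: "('u, 'v) tensor"
  assumes x: "osp_part p x = x"
  shows "hpart (p + q) (act_right \<sigma> x t) = act_right \<sigma> x (hpart q t)"
proof (rule clinear_tensor_homogeneous_eqI[where F = "\<lambda>t. hpart (p + q) (act_right \<sigma> x t)"
      and G = "\<lambda>t. act_right \<sigma> x (hpart q t)"])
  fix r u and w :: 'v assume u: "homogeneous r (u :: 'u)"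
  have "hpart (p + q) (act_right \<sigma> x (u \<otimes> w)) = koszul p r *\<^sub>C (u \<otimes> hpart (p + (q + r)) (\<sigma> x w))"
    by (simp only: act_right_prod[OF u x] hpart_tensor_homogeneous[OF u] hpart_scaleC add.assoc)
  then show "hpart (p + q) (act_right \<sigma> x (u \<otimes> w)) = act_right \<sigma> x (hpart q (u \<otimes> w))"
    by (simp only: Q.hpart_rep[OF x] hpart_tensor_homogeneous[OF u] act_right_prod[OF u x])
qed (intro clinear_compose[OF clinear_hpart] clinear_compose[OF clinear_act_right] clinear_hpart clinear_act_right)+

lemma act_left_bracket:
  fixes t :: "('u, 'v) tensor"
  assumes x: "osp_part p x = x" and y: "osp_part q y = y"
  shows "act_left \<pi> (osp_bracket x y) t
    = act_left \<pi> x (act_left \<pi> y t) - koszul p q *\<^sub>C act_left \<pi> y (act_left \<pi> x t)"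
proof (rule clinear_tensor_homogeneous_eqI[where F = "act_left \<pi> (osp_bracket x y)"
      and G = "\<lambda>t. act_left \<pi> x (act_left \<pi> y t)
        - koszul p q *\<^sub>C act_left \<pi> y (act_left \<pi> x t)"])
  fix r u and w :: 'v assume u: "homogeneous r (u :: 'u)"
  have "\<pi> x (\<pi> y u) \<otimes> w = \<pi> (osp_bracket x y) u \<otimes> w + koszul p q *\<^sub>C (\<pi> y (\<pi> x u) \<otimes> w)"
    by (simp only: P.rep_bracket[OF x y] tensor_prod_simps)
  then show "act_left \<pi> (osp_bracket x y) (u \<otimes> w) = act_left \<pi> x (act_left \<pi> y (u \<otimes> w))
      - koszul p q *\<^sub>C act_left \<pi> y (act_left \<pi> x (u \<otimes> w))"
    by (simp add: act_left_prod[OF u] act_left_prod[OF P.homogeneous_rep[OF x u]]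
        act_left_prod[OF P.homogeneous_rep[OF y u]])
qed (intro clinear_minus clinear_scaled clinear_compose[OF clinear_act_left] clinear_act_left)+

lemma osp_part_bracket:
  assumes x: "osp_part p x = x" and y: "osp_part q y = y"
  shows "osp_part (p + q) (osp_bracket x y) = osp_bracket x y"
  using assms
  by (cases p; cases q) (auto simp: osp_part_fixed osp_bracket_nth)

lemma act_right_bracket:
  fixes t :: "('u, 'v) tensor"
  assumes x: "osp_part p x = x" and y: "osp_part q y = y"
  shows "act_right \<sigma> (osp_bracket x y) t
    = act_right \<sigma> x (act_right \<sigma> y t) - koszul p q *\<^sub>C act_right \<sigma> y (act_right \<sigma> x t)"
proof (rule clinear_tensor_homogeneous_eqI[where F = "act_right \<sigma> (osp_bracket x y)"
      and G = "\<lambda>t. act_right \<sigma> x (act_right \<sigma> y t)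
        - koszul p q *\<^sub>C act_right \<sigma> y (act_right \<sigma> x t)"])
  fix r u and w :: 'v assume u: "homogeneous r (u :: 'u)"
  have "u \<otimes> \<sigma> x (\<sigma> y w) = u \<otimes> \<sigma> (osp_bracket x y) w + koszul p q *\<^sub>C (u \<otimes> \<sigma> y (\<sigma> x w))"
    by (simp only: Q.rep_bracket[OF x y] tensor_prod_simps)
  then show "act_right \<sigma> (osp_bracket x y) (u \<otimes> w) = act_right \<sigma> x (act_right \<sigma> y (u \<otimes> w))
      - koszul p q *\<^sub>C act_right \<sigma> y (act_right \<sigma> x (u \<otimes> w))"
    by (simp add: act_right_prod[OF u x] act_right_prod[OF u y] clinear_scale[OF clinear_act_right]
        act_right_prod[OF u osp_part_bracket[OF x y], unfolded koszul_add] scaleC_add_right scaleC_scaleC mult_ac)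
qed (intro clinear_minus clinear_scaled clinear_compose[OF clinear_act_right] clinear_act_right)+

text \<open>The two factors supercommute, which is the purpose of the sign rule.\<close>

lemma act_left_right_commute:
  fixes t :: "('u, 'v) tensor"
  assumes x: "osp_part p x = x" and y: "osp_part q y = y"
  shows "act_left \<pi> x (act_right \<sigma> y t) = koszul p q *\<^sub>C act_right \<sigma> y (act_left \<pi> x t)"
proof (rule clinear_tensor_homogeneous_eqI[where F = "\<lambda>t. act_left \<pi> x (act_right \<sigma> y t)"
      and G = "\<lambda>t. koszul p q *\<^sub>C act_right \<sigma> y (act_left \<pi> x t)"])
  fix r u and w :: 'v assume u: "homogeneous r (u :: 'u)"
  show "act_left \<pi> x (act_right \<sigma> y (u \<otimes> w)) = koszul p q *\<^sub>C act_right \<sigma> y (act_left \<pi> x (u \<otimes> w))"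
    by (simp add: act_right_prod[OF u y] act_left_prod[OF u] clinear_scale[OF clinear_act_left]
        act_right_prod[OF P.homogeneous_rep[OF x u] y, unfolded koszul_add] scaleC_scaleC
        koszul_commute[of p q] koszul_square mult.assoc[symmetric])
qed (intro clinear_scaled clinear_compose[OF clinear_act_left] clinear_compose[OF clinear_act_right]
    clinear_act_left clinear_act_right)+

lemma act_right_left_commute:
  fixes t :: "('u, 'v) tensor"
  assumes x: "osp_part p x = x" and y: "osp_part q y = y"
  shows "act_right \<sigma> x (act_left \<pi> y t) = koszul p q *\<^sub>C act_left \<pi> y (act_right \<sigma> x t)"
  by (simp add: act_left_right_commute[OF y x] scaleC_scaleC koszul_commute[of p q] koszul_square scaleC_one)

text \<open>Both factors represent the algebra, and by supercommutation the mixed terms of the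
  bracket cancel.\<close>

lemma super_rep_tensor_rep: "super_rep (tensor_rep \<pi> \<sigma> :: osp12 \<Rightarrow> ('u, 'v) tensor \<Rightarrow> _)"
  unfolding super_rep_def
proof (intro conjI allI impI)
  show "clinear (tensor_rep \<pi> \<sigma> x)" for x
    unfolding tensor_rep_def by (intro clinear_plus clinear_act_left clinear_act_right)
  show "Vector_Spaces.linear (*s) (*\<^sub>C) (\<lambda>x. tensor_rep \<pi> \<sigma> x t)" for t
    unfolding Vector_Spaces.linear_iff
    by (auto intro: vec.vector_space_axioms cv.vector_space_axioms
        simp: tensor_rep_def act_left_add act_right_add act_left_scale act_right_scale scaleC_add_right)
  show "homogeneous (p + q) (tensor_rep \<pi> \<sigma> x t)"
    if "osp_part p x = x" "homogeneous q t" for p q x t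
    using hpart_act_left[OF that(1), of q t] hpart_act_right[OF that(1), of q t] that(2)
    by (simp add: homogeneous_def tensor_rep_def hpart_add)
  show "tensor_rep \<pi> \<sigma> (osp_bracket x y) t = tensor_rep \<pi> \<sigma> x (tensor_rep \<pi> \<sigma> y t)
      - koszul p q *\<^sub>C tensor_rep \<pi> \<sigma> y (tensor_rep \<pi> \<sigma> x t)"
    if x: "osp_part p x = x" and y: "osp_part q y = y" for p q x y t
    by (simp add: tensor_rep_def act_left_bracket[OF x y] act_right_bracket[OF x y]
        clinear_add[OF clinear_act_left] clinear_add[OF clinear_act_right] scaleC_add_right
        act_left_right_commute[OF x y] act_right_left_commute[OF x y])
qed

sublocale T: osp_rep "tensor_rep \<pi> \<sigma> :: osp12 \<Rightarrow> ('u, 'v) tensor \<Rightarrow> _"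
  by unfold_locales (rule super_rep_tensor_rep)

lemma clinear_tensor_diff: "clinear (tensor_diff \<pi> \<sigma> x)"
  unfolding tensor_diff_def by (intro clinear_minus clinear_act_left clinear_act_right)

lemma homogeneous_tensor_diff:
  fixes t :: "('u, 'v) tensor"
  assumes "osp_part p x = x" "homogeneous q t"
  shows "homogeneous (p + q) (tensor_diff \<pi> \<sigma> x t)"
  using hpart_act_left[OF assms(1), of q t] hpart_act_right[OF assms(1), of q t] assms(2)
  by (simp add: homogeneous_def tensor_diff_def clinear_diff[OF clinear_hpart])

text \<open>The operators \<open>y \<otimes> 1 - 1 \<otimes> y\<close> form a copy of the adjoint representation under the diagonal
  action: the sign in front of the second factor is carried along, and the mixed terms cancel as
  before.\<close>

lemma tensor_rep_diff_bracket:
  fixes t :: "('u, 'v) tensor"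
  assumes x: "osp_part p x = x" and y: "osp_part q y = y"
  shows "tensor_rep \<pi> \<sigma> x (tensor_diff \<pi> \<sigma> y t)
    = tensor_diff \<pi> \<sigma> (osp_bracket x y) t + koszul p q *\<^sub>C tensor_diff \<pi> \<sigma> y (tensor_rep \<pi> \<sigma> x t)"
  by (simp add: tensor_rep_def tensor_diff_def act_left_bracket[OF x y] act_right_bracket[OF x y]
      clinear_add[OF clinear_act_left] clinear_add[OF clinear_act_right]
      clinear_diff[OF clinear_act_left] clinear_diff[OF clinear_act_right]
      scaleC_add_right cv.scale_right_diff_distrib
      act_left_right_commute[OF x y] act_right_left_commute[OF x y])

end

section \<open>The step operator\<close>

context osp_tensor
begin

abbreviation T :: "osp12 \<Rightarrow> ('u, 'v) tensor \<Rightarrow> ('u, 'v) tensor"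
  where "T \<equiv> tensor_rep \<pi> \<sigma>"

abbreviation D :: "osp12 \<Rightarrow> ('u, 'v) tensor \<Rightarrow> ('u, 'v) tensor"
  where "D \<equiv> tensor_diff \<pi> \<sigma>"

lemma tensor_diff_scale_arg: "D (c *s x) t = c *\<^sub>C D x t"
  by (simp add: tensor_diff_def act_left_scale act_right_scale cv.scale_right_diff_distrib)

lemma tensor_diff_zero_arg: "D 0 t = 0"
  using tensor_diff_scale_arg[of 0 0 t] by simp

lemma tensor_diff_minus_arg: "D (- x) t = - D x t"
  using tensor_diff_scale_arg[of "-1" x t] by (simp add: scaleC_one)

text \<open>The instances of the adjoint action of \<open>x\<^sub>\<alpha>\<close> that enter the step operator.\<close>

lemma raise_tensor_diff:
  "T x_a (D x_ma t) = D x_h t - D x_ma (T x_a t)"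
  "T x_a (D x_h t) = D x_a t + D x_h (T x_a t)"
  "T x_a (D x_a t) = - (2 *\<^sub>C D x_2a t) - D x_a (T x_a t)"
  "T x_a (D x_2a t) = D x_2a (T x_a t)"
  using tensor_rep_diff_bracket[of 1 x_a 1 x_ma t] tensor_rep_diff_bracket[of 1 x_a 0 x_h t]
    tensor_rep_diff_bracket[of 1 x_a 1 x_a t] tensor_rep_diff_bracket[of 1 x_a 0 x_2a t]
  by (simp_all add: osp_bracket_basis koszul_def scaleC_one tensor_diff_scale_arg
      tensor_diff_minus_arg tensor_diff_zero_arg)

lemma weight_tensor_diff:
  assumes "T x_h w = \<mu> *\<^sub>C w"
  shows "T x_h (D x_ma w) = (\<mu> + 1) *\<^sub>C D x_ma w"
    "T x_h (D x_h w) = \<mu> *\<^sub>C D x_h w"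
    "T x_h (D x_a w) = (\<mu> - 1) *\<^sub>C D x_a w"
    "T x_h (D x_2a w) = (\<mu> - 2) *\<^sub>C D x_2a w"
  using tensor_rep_diff_bracket[of 0 x_h 1 x_ma w] tensor_rep_diff_bracket[of 0 x_h 0 x_h w]
    tensor_rep_diff_bracket[of 0 x_h 1 x_a w] tensor_rep_diff_bracket[of 0 x_h 0 x_2a w]
  by (simp_all add: assms osp_bracket_basis koszul_def scaleC_one tensor_diff_scale_arg
      tensor_diff_minus_arg tensor_diff_zero_arg clinear_scale[OF clinear_tensor_diff]
      scaleC_add_left cv.scale_left_diff_distrib)

text \<open>The value of the step operator on a vector of weight \<open>\<mu>\<close>.  The operators \<open>H - 1\<close> and \<open>H - 2\<close> are
  inverted on vectors of weight \<open>\<mu> + 1\<close>, where they are the scalars \<open>\<mu>\<close> and \<open>\<mu> - 1\<close>.\<close>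

definition step_vector :: "complex \<Rightarrow> ('u, 'v) tensor \<Rightarrow> ('u, 'v) tensor"
  where "step_vector \<mu> w = D x_ma w - (1 / \<mu>) *\<^sub>C T x_ma (D x_h w)
    - (1 / \<mu>) *\<^sub>C T x_ma (T x_ma (D x_a w))
    - (2 / (\<mu> * (\<mu> - 1))) *\<^sub>C T x_ma (T x_ma (T x_ma (D x_2a w)))"

lemma weight_step_summands:
  assumes "T x_h w = \<mu> *\<^sub>C w"
  shows "T x_h (T x_ma (D x_h w)) = (\<mu> + 1) *\<^sub>C T x_ma (D x_h w)"
    and "T x_h (T x_ma (T x_ma (D x_a w))) = (\<mu> + 1) *\<^sub>C T x_ma (T x_ma (D x_a w))"
    and "T x_h (T x_ma (T x_ma (T x_ma (D x_2a w)))) = (\<mu> + 1) *\<^sub>C T x_ma (T x_ma (T x_ma (D x_2a w)))"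
  using T.weight_lowering_pow[OF weight_tensor_diff(2)[OF assms], of 1]
    T.weight_lowering_pow[OF weight_tensor_diff(3)[OF assms], of 2]
    T.weight_lowering_pow[OF weight_tensor_diff(4)[OF assms], of 3]
  by (simp_all add: numeral_eq_Suc)

text \<open>Injectivity suffices to evaluate the inverses, since preimages of the vectors in question are
  explicit.\<close>

lemma step_op_eq_step_vector:
  assumes w: "T x_h w = \<mu> *\<^sub>C w" and \<mu>: "\<mu> \<noteq> 0" "\<mu> \<noteq> 1"
    and inj1: "inj (\<lambda>w. T x_h w - w)" and inj2: "inj (\<lambda>w. T x_h w - 2 *\<^sub>C w)"
  shows "step_op \<pi> \<sigma> w = step_vector \<mu> w"
proof -
  let ?H1 = "\<lambda>w. T x_h w - w" and ?H2 = "\<lambda>w. T x_h w - 2 *\<^sub>C w"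
  have H1: "inv ?H1 z = (1 / \<mu>) *\<^sub>C z" if z: "T x_h z = (\<mu> + 1) *\<^sub>C z" for z
  proof -
    have "?H1 ((1 / \<mu>) *\<^sub>C z) = z"
      using \<mu> by (simp add: T.L.scale z scaleC_scaleC cv.scale_left_diff_distrib[symmetric]
          add_divide_distrib scaleC_one)
    then show ?thesis using inv_f_f[OF inj1] by metis
  qed
  have H2: "inv (?H2 \<circ> ?H1) z = (1 / (\<mu> * (\<mu> - 1))) *\<^sub>C z" if z: "T x_h z = (\<mu> + 1) *\<^sub>C z" for z
  proof -
    have a: "?H1 (c *\<^sub>C z) = (c * \<mu>) *\<^sub>C z" for c
      by (simp add: T.L.scale z scaleC_scaleC cv.scale_left_diff_distrib[symmetric] algebra_simps)
    have b: "?H2 (c *\<^sub>C z) = (c * (\<mu> - 1)) *\<^sub>C z" for c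
    proof -
      have "c * (\<mu> - 1) = c * (\<mu> + 1) - 2 * c" by (simp add: algebra_simps)
      then show ?thesis by (simp only: T.L.scale z scaleC_scaleC cv.scale_left_diff_distrib)
    qed
    have "(?H2 \<circ> ?H1) ((1 / (\<mu> * (\<mu> - 1))) *\<^sub>C z) = ?H2 ((1 / (\<mu> * (\<mu> - 1)) * \<mu>) *\<^sub>C z)"
      by (simp only: o_def a)
    also have "\<dots> = z"
      unfolding b using \<mu> by (simp add: scaleC_one)
    finally have eq: "(?H2 \<circ> ?H1) ((1 / (\<mu> * (\<mu> - 1))) *\<^sub>C z) = z" .
    have "inv (?H2 \<circ> ?H1) ((?H2 \<circ> ?H1) ((1 / (\<mu> * (\<mu> - 1))) *\<^sub>C z))
        = (1 / (\<mu> * (\<mu> - 1))) *\<^sub>C z"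
      by (rule inv_f_f[OF inj_compose[OF inj2 inj1]])
    then show ?thesis unfolding eq .
  qed
  show ?thesis
    unfolding step_op_def Let_def step_vector_def
    by (simp add: numeral_2_eq_2 numeral_3_eq_3 H1[OF weight_step_summands(1)[OF w]]
        H1[OF weight_step_summands(2)[OF w]] H2[OF weight_step_summands(3)[OF w]] scaleC_scaleC)
qed

text \<open>With \<open>A = h~ w\<close>, \<open>B = X x~\<^sub>\<alpha> w\<close> and \<open>C = X\<^sup>2 x~\<^bsub>2\<alpha>\<^esub> w\<close>, where \<open>X\<close> is the diagonal \<open>x\<^bsub>-\<alpha>\<^esub>\<close> and \<open>x~\<close> means
  \<open>x \<otimes> 1 - 1 \<otimes> x\<close>, raising turns the four terms into \<open>A\<close>, \<open>\<mu> A - B\<close>, \<open>B - 2 C\<close> and \<open>(\<mu> - 1) C\<close>.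
  The coefficients of the step operator are those for which this telescopes to zero.\<close>

lemma singular_step_vector:
  assumes w: "singular_vector T \<mu> w" and \<mu>: "\<mu> \<noteq> 0" "\<mu> \<noteq> 1"
  shows "singular_vector T (\<mu> + 1) (step_vector \<mu> w)"
proof -
  have wt: "T x_h w = \<mu> *\<^sub>C w" and a: "T x_a w = 0"
    using w by (auto simp: singular_vector_def)
  have D0: "D x 0 = 0" for x using clinear_scale[OF clinear_tensor_diff, of x 0 0] by simp
  let ?A = "D x_h w" and ?B = "T x_ma (D x_a w)" and ?C = "T x_ma (T x_ma (D x_2a w))"
  have 1: "T x_a (D x_ma w) = ?A"
    by (simp add: raise_tensor_diff a D0)
  have 2: "T x_a (T x_ma ?A) = \<mu> *\<^sub>C ?A - ?B"
    by (simp add: T.rep_a_ma weight_tensor_diff[OF wt] raise_tensor_diff a D0)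
  have 3: "T x_a (T x_ma ?B) = ?B - 2 *\<^sub>C ?C"
  proof -
    have "T x_a ?B = (\<mu> - 1) *\<^sub>C D x_a w + 2 *\<^sub>C T x_ma (D x_2a w)"
      by (simp add: T.rep_a_ma[of "D x_a w"] weight_tensor_diff[OF wt] raise_tensor_diff a D0
          T.L.neg T.L.scale)
    then have "T x_ma (T x_a ?B) = (\<mu> - 1) *\<^sub>C ?B + 2 *\<^sub>C ?C"
      by (simp add: T.L.add T.L.scale)
    moreover have "T x_h ?B = \<mu> *\<^sub>C ?B"
      using T.weight_lowering_pow[OF weight_tensor_diff(3)[OF wt], of 1] by simp
    ultimately show ?thesis
      by (simp add: T.rep_a_ma[of ?B] cv.scale_left_diff_distrib scaleC_one)
  qed
  have 4: "T x_a (T x_ma ?C) = (\<mu> - 1) *\<^sub>C ?C"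
  proof -
    \<comment> \<open>The vector \<open>x~\<^bsub>2\<alpha>\<^esub> w\<close> is itself singular, of weight \<open>\<mu> - 2\<close>, so the ladder scalar applies.\<close>
    have ladder: "ladder (\<mu> - 2) 3 = \<mu> - 1" by (simp add: ladder_def)
    have "singular_vector T (\<mu> - 2) (D x_2a w)"
      by (simp add: singular_vector_def weight_tensor_diff[OF wt] raise_tensor_diff a D0)
    from T.raising_lowering_pow[OF this, of 3] show ?thesis
      unfolding ladder by (simp add: numeral_3_eq_3)
  qed
  have "T x_a (step_vector \<mu> w)
      = ?A - (1 / \<mu>) *\<^sub>C (\<mu> *\<^sub>C ?A - ?B) - (1 / \<mu>) *\<^sub>C (?B - 2 *\<^sub>C ?C)
        - (2 / (\<mu> * (\<mu> - 1))) *\<^sub>C (\<mu> - 1) *\<^sub>C ?C"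
    unfolding step_vector_def T.L.diff T.L.scale 1 2 3 4 ..
  also have "\<dots> = 0"
  proof -
    have "2 / (\<mu> * (\<mu> - 1)) * (\<mu> - 1) = 2 / \<mu>"
      using \<mu> by (simp add: divide_simps)
    then have last: "(2 / (\<mu> * (\<mu> - 1))) *\<^sub>C (\<mu> - 1) *\<^sub>C ?C = (2 / \<mu>) *\<^sub>C ?C"
      by (simp only: scaleC_scaleC)
    show ?thesis
      unfolding last
      using \<mu> by (simp add: cv.scale_right_diff_distrib scaleC_scaleC scaleC_one)
  qed
  finally have "T x_a (step_vector \<mu> w) = 0" .
  moreover have "T x_h (step_vector \<mu> w) = (\<mu> + 1) *\<^sub>C step_vector \<mu> w"
    unfolding step_vector_def T.L.diff T.L.scale weight_tensor_diff(1)[OF wt] weight_step_summands[OF wt]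
    by (simp only: cv.scale_right_diff_distrib scaleC_scaleC mult.commute)
  ultimately show ?thesis by (simp add: singular_vector_def)
qed

lemma homogeneous_step_vector:
  assumes w: "homogeneous p w"
  shows "homogeneous (p + 1) (step_vector \<mu> w)"
proof -
  have ma: "homogeneous q (T x_ma z)" if "homogeneous (q + 1) z" for q z
    using T.homogeneous_rep[OF osp_part_basis(2) that] by (cases q) simp_all
  have 1: "homogeneous (p + 1) (D x_ma w)" "homogeneous p (D x_h w)"
      "homogeneous (p + 1) (D x_a w)" "homogeneous p (D x_2a w)"
    using homogeneous_tensor_diff[OF osp_part_basis(2) w] homogeneous_tensor_diff[OF osp_part_basis(3) w]
      homogeneous_tensor_diff[OF osp_part_basis(4) w] homogeneous_tensor_diff[OF osp_part_basis(5) w]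
    by (cases p; simp)+
  have 2: "p + 1 + 1 = p" by (cases p) simp_all
  have "homogeneous (p + 1) (T x_ma (D x_h w))" "homogeneous (p + 1) (T x_ma (T x_ma (D x_a w)))"
    "homogeneous (p + 1) (T x_ma (T x_ma (T x_ma (D x_2a w))))"
    by (intro ma; unfold 2; intro ma 1; unfold 2; rule 1)+
  with 1 show ?thesis
    by (simp only: step_vector_def homogeneous_def clinear_diff[OF clinear_hpart] hpart_scaleC)
qed

end

section \<open>The leading scalar of the step operator\<close>

text \<open>If the coefficient of \<open>x\<^sup>0\<close> in a singular tensor is \<open>f\<^sup>j v \<noteq> 0\<close>, with \<open>v\<close> of weight \<open>\<xi>\<close>, then the tensor has
  weight \<open>\<mu> = \<xi> + j + 1/2\<close>, and the coefficient of \<open>x\<^sup>0\<close> after one step is this scalar divided by \<open>\<mu>\<close>,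
  times \<open>f\<^bsup>j+1\<^esup> v\<close>.\<close>

definition step_coeff :: "complex \<Rightarrow> nat \<Rightarrow> complex"
  where "step_coeff \<xi> j = - 1 + 2 * ladder \<xi> j
    - 4 * (ladder \<xi> j * ladder \<xi> (j - 1)) / (\<xi> + of_nat j - 1 / 2)"

lemma step_coeff_mult:
  assumes "\<xi> + of_nat j - 1 / 2 \<noteq> 0"
  shows "(\<xi> + of_nat j - 1 / 2) * step_coeff \<xi> j
    = (if even j then (of_nat j + 1) * (1 / 2 - \<xi>) else (\<xi> - 1 / 2) * (2 * \<xi> + of_nat j))"
proof -
  have "(\<xi> + of_nat j - 1 / 2) * step_coeff \<xi> j
      = (\<xi> + of_nat j - 1 / 2) * (2 * ladder \<xi> j - 1) - 4 * (ladder \<xi> j * ladder \<xi> (j - 1))"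
    using assms unfolding step_coeff_def right_diff_distrib times_divide_eq_right
    by (subst nonzero_mult_div_cancel_left) (auto simp: algebra_simps)
  also have "\<dots> = (if even j then (of_nat j + 1) * (1 / 2 - \<xi>) else (\<xi> - 1 / 2) * (2 * \<xi> + of_nat j))"
  proof (cases "even j")
    case True
    then obtain m where "j = 2 * m" by (elim evenE)
    moreover have "ladder \<xi> (2 * m - 1) = of_nat m - 1 + \<xi>" if m: "m > 0"
    proof -
      obtain i where "m = Suc i" using m by (cases m) auto
      then show ?thesis by (simp add: ladder_def)
    qed
    ultimately show ?thesis
      by (cases "m = 0") (simp_all add: ladder_def, simp add: field_simps)
  next
    case False
    then obtain m where "j = 2 * m + 1" by (elim oddE)
    then show ?thesis by (simp add: ladder_def field_simps)
  qed
  finally show ?thesis .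
qed

lemma half_plus_int_neq: "(1 / 2 :: complex) + of_int i \<noteq> of_int k"
proof
  assume "(1 / 2 :: complex) + of_int i = of_int k"
  then have "of_int (1 + 2 * i) = (of_int (2 * k) :: complex)"
    by (simp add: field_simps)
  then have "1 + 2 * i = 2 * k" by (simp only: of_int_eq_iff)
  then show False by presburger
qed

text \<open>For even \<open>j\<close> the scalar is a multiple of \<open>(j + 1)(\<ell> + 1/2)\<close>, for odd \<open>j\<close> of
  \<open>(\<ell> + 1/2)(j - 2\<ell>)\<close>; the last factor is odd.\<close>

lemma step_coeff_neq_0: "step_coeff (- of_nat l) j \<noteq> 0"
proof
  assume zero: "step_coeff (- of_nat l) j = 0"
  have half: "(1 / 2 :: complex) + of_nat i \<noteq> of_nat k" for i k
    using half_plus_int_neq[of "int i" "int k"] by simp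
  have "- of_nat l + of_nat j - 1 / 2 \<noteq> (0 :: complex)"
    using half[of l j] by (auto simp: algebra_simps)
  from step_coeff_mult[OF this] have "(if even j then (of_nat j + 1) * (1 / 2 + of_nat l)
      else (- of_nat l - 1 / 2) * (- (2 * of_nat l) + of_nat j)) = (0 :: complex)"
    by (simp only: zero mult_zero_right diff_minus_eq_add mult_minus_right)
  moreover have "(of_nat j + 1 :: complex) \<noteq> 0" by (metis of_nat_Suc of_nat_neq_0 add.commute)
  moreover have "(1 / 2 + of_nat l :: complex) \<noteq> 0" using half[of l 0] by simp
  moreover have "(- of_nat l - 1 / 2 :: complex) \<noteq> 0"
  proof -
    have "(- of_nat l - 1 / 2 :: complex) = - (1 / 2 + of_nat l)" by simp
    then show ?thesis using half[of l 0] by (simp only: neg_equal_0_iff_equal of_nat_0 not_False_eq_True)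
  qed
  moreover have "(- (2 * of_nat l) + of_nat j :: complex) \<noteq> 0" if "odd j"
  proof
    assume "- (2 * of_nat l) + of_nat j = (0 :: complex)"
    then have "of_nat j = (of_nat (2 * l) :: complex)" by (simp add: algebra_simps)
    then have "j = 2 * l" by (simp only: of_nat_eq_iff)
    with that show False by simp
  qed
  ultimately show False by (auto split: if_splits)
qed

section \<open>Components of tensors with a polynomial factor\<close>

text \<open>The tensor product with \<open>C[x]\<close> is the space of polynomials with coefficients in the second
  factor, and this is the coefficient of \<open>x\<^sup>n\<close>.\<close>

definition component :: "nat \<Rightarrow> (complex poly, 'v::cvector) tensor \<Rightarrow> 'v"
  where "component n = tensor_lift (\<lambda>f v. coeff f n *\<^sub>C v)"

lemma cbilinear_component: "cbilinear (\<lambda>f (v :: 'v::cvector). coeff (f :: complex poly) n *\<^sub>C v)"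
  by (rule cbilinearI)
    (simp_all add: scaleC_add_left scaleC_add_right scaleC_scaleC scaleC_poly_complex mult_ac)

lemma component_prod: "component n (f \<otimes> v) = coeff f n *\<^sub>C v"
  unfolding component_def by (rule tensor_lift_prod[OF cbilinear_component])

lemma clinear_component: "clinear (component n)"
  unfolding component_def by (rule clinear_tensor_lift[OF cbilinear_component])

text \<open>In the expansion the bound is eventual rather than exact, so that expansions of two tensors can
  be added.\<close>

lemma component_eventually_0: "\<exists>N. \<forall>n\<ge>N. component n t = 0"
  and component_expansion: "\<exists>N. \<forall>M\<ge>N. t = (\<Sum>n\<le>M. monom 1 n \<otimes> component n t)"
  for t :: "(complex poly, 'v::cvector) tensor"
proof -
  note add = clinear_add[OF clinear_component] and scale = clinear_scale[OF clinear_component]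
  have t: "t \<in> cv.span (\<Union>u v. {u \<otimes> v})" by (simp add: span_tensor_prod)
  have zero: "component n 0 = 0" for n using scale[of n 0 0] by simp
  show "\<exists>N. \<forall>n\<ge>N. component n t = 0"
    using t
  proof (induction rule: cv.span_induct_alt)
    case base
    show ?case by (simp add: zero)
  next
    case (step c x y)
    then obtain f v N where x: "x = f \<otimes> v" and N: "\<forall>n\<ge>N. component n y = 0" by blast
    have "component n (c *\<^sub>C x + y) = 0" if "n \<ge> max N (Suc (degree f))" for n
      using that N by (simp add: add scale x component_prod coeff_eq_0)
    then show ?case by blast
  qed
  show "\<exists>N. \<forall>M\<ge>N. t = (\<Sum>n\<le>M. monom 1 n \<otimes> component n t)"
    using t
  proof (induction rule: cv.span_induct_alt)
    case base
    show ?case by (simp add: zero)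
  next
    case (step c x y)
    then obtain f v N where x: "x = f \<otimes> v" and N: "\<forall>M\<ge>N. y = (\<Sum>n\<le>M. monom 1 n \<otimes> component n y)"
      by blast
    have "c *\<^sub>C x + y = (\<Sum>n\<le>M. monom 1 n \<otimes> component n (c *\<^sub>C x + y))"
      if M: "M \<ge> max N (degree f)" for M
    proof -
      have sum_left: "(\<Sum>n\<in>A. g n) \<otimes> v = (\<Sum>n\<in>A. g n \<otimes> v)" for g :: "nat \<Rightarrow> complex poly" and A
        by (induction A rule: infinite_finite_induct) (simp_all add: tensor_prod_add_left)
      have "(\<Sum>n\<le>M. monom 1 n \<otimes> component n x) = (\<Sum>n\<le>M. monom (coeff f n) n \<otimes> v)"
        by (intro sum.cong refl)
          (simp add: x component_prod tensor_prod_scale_right tensor_prod_scale_left[symmetric]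
            scaleC_poly_complex smult_monom)
      also have "\<dots> = x"
        using M by (simp add: sum_left[symmetric] poly_as_sum_of_monoms' x)
      finally have cx: "c *\<^sub>C x = (\<Sum>n\<le>M. c *\<^sub>C (monom 1 n \<otimes> component n x))"
        by (simp add: cv.scale_sum_right[symmetric])
      have y: "y = (\<Sum>n\<le>M. monom 1 n \<otimes> component n y)"
        using N M by simp
      have "(\<Sum>n\<le>M. monom 1 n \<otimes> component n (c *\<^sub>C x + y))
          = (\<Sum>n\<le>M. c *\<^sub>C (monom 1 n \<otimes> component n x)) + (\<Sum>n\<le>M. monom 1 n \<otimes> component n y)"
        by (simp add: add scale tensor_prod_add_right tensor_prod_scale_right sum.distrib)
      also have "\<dots> = c *\<^sub>C x + y"
        by (rule arg_cong2[where f = "(+)", OF cx[symmetric] y[symmetric]])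
      finally show ?thesis by (rule sym)
    qed
    then show ?case by blast
  qed
qed

lemma component_eqI:
  assumes "\<And>n. component n t = 0" shows "t = 0"
  using component_expansion[of t] by (auto simp: assms)

locale polynomial_tensor = Q: osp_rep \<sigma>
  for \<sigma> :: "osp12 \<Rightarrow> 'v::super_vector \<Rightarrow> 'v" +
  fixes a b :: complex
  assumes ab: "a * b = 1 / 2"
begin

sublocale osp_tensor "poly_rep a b" \<sigma>
  by (unfold_locales) (rule super_rep_poly_rep[OF ab])

lemma a_neq_0: "a \<noteq> 0"
  using ab by auto

lemma component_act_left:
  "component n (act_left (poly_rep a b) x_a t) = (a * of_nat (Suc n)) *\<^sub>C component (Suc n) t"
  "component 0 (act_left (poly_rep a b) x_ma t) = 0"
  "component n (act_left (poly_rep a b) x_h t) = (of_nat n + 1 / 2) *\<^sub>C component n t"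
  for t :: "(complex poly, 'v) tensor"
proof -
  note lin = clinear_compose[OF clinear_component clinear_act_left]
  show "component n (act_left (poly_rep a b) x_a t) = (a * of_nat (Suc n)) *\<^sub>C component (Suc n) t"
    by (rule clinear_tensor_homogeneous_eqI[OF lin clinear_scaled[OF clinear_component]])
      (simp add: act_left_prod component_prod coeff_poly_rep x_a_def axis_def scaleC_scaleC)
  show "component 0 (act_left (poly_rep a b) x_ma t) = 0"
    by (rule clinear_tensor_homogeneous_eqI[OF lin, where G = "\<lambda>_. 0"])
      (simp_all add: act_left_prod component_prod coeff_poly_rep x_ma_def axis_def clinearI)
  show "component n (act_left (poly_rep a b) x_h t) = (of_nat n + 1 / 2) *\<^sub>C component n t"
    by (rule clinear_tensor_homogeneous_eqI[OF lin clinear_scaled[OF clinear_component]])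
      (simp add: act_left_prod component_prod coeff_poly_rep x_h_def axis_def scaleC_scaleC)
qed

lemma component_act_right:
  fixes t :: "(complex poly, 'v) tensor"
  assumes x: "osp_part q x = x"
  shows "component n (act_right \<sigma> x t) = koszul q (of_nat n) *\<^sub>C \<sigma> x (component n t)"
proof (rule clinear_tensor_homogeneous_eqI[where F = "\<lambda>t. component n (act_right \<sigma> x t)"
      and G = "\<lambda>t. koszul q (of_nat n) *\<^sub>C \<sigma> x (component n t)"])
  fix p and f :: "complex poly" and w :: 'v assume f: "homogeneous p f"
  have "coeff f n = 0" if "of_nat n \<noteq> p"
    using f that unfolding homogeneous_def by (metis coeff_hpart)
  then show "component n (act_right \<sigma> x (f \<otimes> w)) = koszul q (of_nat n) *\<^sub>C \<sigma> x (component n (f \<otimes> w))"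
    by (cases "of_nat n = p")
      (simp_all add: act_right_prod[OF f x] component_prod clinear_scale[OF clinear_component]
        Q.L.scale Q.L.zero)
qed (intro clinear_compose[OF clinear_component clinear_act_right]
    clinear_scaled[OF clinear_compose[OF Q.clinear_rep clinear_component]])+

lemma component_raise:
  "component n (T x_a t) = (a * of_nat (Suc n)) *\<^sub>C component (Suc n) t
    + koszul 1 (of_nat n) *\<^sub>C \<sigma> x_a (component n t)"
  by (simp add: tensor_rep_def clinear_add[OF clinear_component] component_act_left(1)
      component_act_right[OF osp_part_basis(4)])

lemma component_weight:
  "component n (T x_h t) = (of_nat n + 1 / 2) *\<^sub>C component n t + \<sigma> x_h (component n t)"
  by (simp add: tensor_rep_def clinear_add[OF clinear_component] component_act_left(3)
      component_act_right[OF osp_part_basis(3)] koszul_def scaleC_one)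

lemma component_0_lower: "component 0 (T x_ma t) = \<sigma> x_ma (component 0 t)"
  by (simp add: tensor_rep_def clinear_add[OF clinear_component] component_act_left(2)
      component_act_right[OF osp_part_basis(2)] koszul_def scaleC_one)

text \<open>On a vector killed by the diagonal \<open>x\<close> the difference operator is \<open>-2 (1 \<otimes> x)\<close>, and on the
  coefficient of \<open>x\<^sup>0\<close> the super sign is trivial.\<close>

lemma component_0_diff:
  assumes "osp_part q x = x"
  shows "component 0 (D x t) = component 0 (T x t) - 2 *\<^sub>C \<sigma> x (component 0 t)"
proof -
  have "D x t = T x t - 2 *\<^sub>C act_right \<sigma> x t"
    by (simp add: tensor_diff_def tensor_rep_def scaleC_double)
  then show ?thesis
    by (simp add: clinear_diff[OF clinear_component] clinear_scale[OF clinear_component]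
        component_act_right[OF assms] koszul_def scaleC_one)
qed

text \<open>The coefficient of \<open>x\<^sup>n\<close> in \<open>x\<^sub>\<alpha> t = 0\<close> is a recursion: it expresses the coefficient \<open>n + 1\<close> of \<open>t\<close> through
  the coefficient \<open>n\<close>.\<close>

lemma kernel_component_0:
  assumes "T x_a t = 0" and "component 0 t = 0"
  shows "t = 0"
proof (rule component_eqI)
  show "component n t = 0" for n
  proof (induction n)
    case (Suc n)
    have "component n (T x_a t) = 0"
      using assms(1) clinear_scale[OF clinear_component, of n 0 0] by simp
    then have "(a * of_nat (Suc n)) *\<^sub>C component (Suc n) t = 0"
      by (simp add: component_raise Suc Q.L.zero)
    moreover have "a * of_nat (Suc n) \<noteq> 0" using a_neq_0 of_nat_neq_0 by (metis mult_eq_0_iff)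
    ultimately show ?case by (metis cv.scale_eq_0_iff)
  qed (rule assms(2))
qed

text \<open>Taking the coefficient of \<open>x\<^sup>0\<close> turns the diagonal \<open>x\<^bsub>-\<alpha>\<^esub>\<close> into \<open>f\<close> and the difference operators
  into multiples of \<open>f\<close>, \<open>h\<close>, \<open>e\<close>, \<open>e\<^sup>2\<close> acting on the string of \<open>v\<close>.  So the step operator becomes
  \<open>f\<close> times a combination of ladder scalars.\<close>

lemma component_0_step_vector:
  assumes \<mu>_eq: "\<mu> = \<xi> + of_nat j + 1 / 2"
    and w: "singular_vector T \<mu> w"
    and v: "singular_vector \<sigma> \<xi> v"
    and y: "component 0 w = \<beta> *\<^sub>C (\<sigma> x_ma ^^ j) v"
    and \<mu>: "\<mu> \<noteq> 0" "\<mu> \<noteq> 1"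
  shows "component 0 (step_vector \<mu> w) = (\<beta> * step_coeff \<xi> j / \<mu>) *\<^sub>C (\<sigma> x_ma ^^ Suc j) v"
proof -
  let ?y = "component 0 w" and ?F = "\<sigma> x_ma" and ?E = "\<sigma> x_a"
  let ?z = "(?F ^^ Suc j) v"
  have wt: "T x_h w = \<mu> *\<^sub>C w" and a: "T x_a w = 0"
    using w by (auto simp: singular_vector_def)
  have comp0: "component 0 0 = (0 :: 'v)"
    using clinear_scale[OF clinear_component, of 0 0 0] by simp
  have hv: "\<sigma> x_h ?y = (\<xi> + of_nat j) *\<^sub>C ?y"
    using Q.weight_lowering_pow[of v \<xi> j] v
    by (simp add: y Q.L.scale singular_vector_def scaleC_scaleC mult.commute)
  have 1: "component 0 (D x_ma w) = - ?F ?y"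
    using component_0_diff[OF osp_part_basis(2), of w]
    by (simp add: component_0_lower scaleC_double)
  have 2: "component 0 (T x_ma (D x_h w)) = (1 - \<mu>) *\<^sub>C ?F ?y"
  proof -
    have "component 0 (D x_h w) = \<mu> *\<^sub>C ?y - (2 * (\<xi> + of_nat j)) *\<^sub>C ?y"
      using component_0_diff[OF osp_part_basis(3), of w]
      by (simp add: wt clinear_scale[OF clinear_component] hv scaleC_scaleC)
    also have "\<dots> = (1 - \<mu>) *\<^sub>C ?y"
      unfolding cv.scale_left_diff_distrib[symmetric] \<mu>_eq by (simp add: algebra_simps)
    finally show ?thesis by (simp only: component_0_lower Q.L.scale)
  qed
  have 3: "component 0 (T x_ma (T x_ma (D x_a w))) = - (2 *\<^sub>C ?F (?F (?E ?y)))"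
    using component_0_diff[OF osp_part_basis(4), of w]
    by (simp add: a comp0 component_0_lower Q.L.scale Q.L.neg)
  have 4: "component 0 (T x_ma (T x_ma (T x_ma (D x_2a w)))) = 2 *\<^sub>C ?F (?F (?F (?E (?E ?y))))"
    using component_0_diff[OF osp_part_basis(5), of w]
    by (simp add: T.rep_2a Q.rep_2a a T.L.zero comp0 component_0_lower Q.L.scale Q.L.neg)
  have Fy: "?F ?y = \<beta> *\<^sub>C ?z"
    by (simp add: y Q.L.scale)
  have FFEy: "?F (?F (?E ?y)) = (\<beta> * ladder \<xi> j) *\<^sub>C ?z"
  proof -
    have E: "?E ?y = (\<beta> * ladder \<xi> j) *\<^sub>C (?F ^^ (j - 1)) v"
      by (simp add: y Q.L.scale Q.raising_lowering_pow[OF v] scaleC_scaleC)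
    show ?thesis
      unfolding E by (cases j) (simp_all add: ladder_0 Q.L.zero Q.L.scale)
  qed
  have FFFEEy: "?F (?F (?F (?E (?E ?y)))) = (\<beta> * (ladder \<xi> j * ladder \<xi> (j - 1))) *\<^sub>C ?z"
  proof -
    have E: "?E (?E ?y) = (\<beta> * (ladder \<xi> j * ladder \<xi> (j - 1))) *\<^sub>C (?F ^^ (j - 1 - 1)) v"
      by (simp add: y Q.L.scale Q.raising_lowering_pow[OF v] scaleC_scaleC)
    consider "j = 0" | "j = 1" | i where "j = Suc (Suc i)"
      by (metis One_nat_def not0_implies_Suc)
    then show ?thesis
      unfolding E by cases (simp_all add: ladder_0 Q.L.zero Q.L.scale)
  qed
  have "component 0 (step_vector \<mu> w)
      = - (\<beta> *\<^sub>C ?z) - (1 / \<mu>) *\<^sub>C (1 - \<mu>) *\<^sub>C \<beta> *\<^sub>C ?z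
        - (1 / \<mu>) *\<^sub>C (- (2 *\<^sub>C (\<beta> * ladder \<xi> j) *\<^sub>C ?z))
        - (2 / (\<mu> * (\<mu> - 1))) *\<^sub>C 2 *\<^sub>C (\<beta> * (ladder \<xi> j * ladder \<xi> (j - 1))) *\<^sub>C ?z"
    unfolding step_vector_def clinear_diff[OF clinear_component] clinear_scale[OF clinear_component]
      1 2 3 4 Fy FFEy FFFEEy ..
  also have "\<dots> = (- \<beta> - 1 / \<mu> * (1 - \<mu>) * \<beta> + 1 / \<mu> * 2 * (\<beta> * ladder \<xi> j)
      - 2 / (\<mu> * (\<mu> - 1)) * 2 * (\<beta> * (ladder \<xi> j * ladder \<xi> (j - 1)))) *\<^sub>C ?z"
    by (simp only: cv.scale_left_diff_distrib scaleC_add_left cv.scale_minus_left cv.scale_minus_right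
        scaleC_scaleC mult.assoc diff_minus_eq_add)
  also have "- \<beta> - 1 / \<mu> * (1 - \<mu>) * \<beta> + 1 / \<mu> * 2 * (\<beta> * ladder \<xi> j)
      - 2 / (\<mu> * (\<mu> - 1)) * 2 * (\<beta> * (ladder \<xi> j * ladder \<xi> (j - 1)))
      = \<beta> * (- 1 + 2 * ladder \<xi> j - 4 * (ladder \<xi> j * ladder \<xi> (j - 1)) / (\<mu> - 1)) / \<mu>"
  proof -
    have "- \<beta> - 1 / m * (1 - m) * \<beta> + 1 / m * 2 * (\<beta> * c) - 2 / (m * (m - 1)) * 2 * (\<beta> * d)
      = \<beta> * (- 1 + 2 * c - 4 * d / (m - 1)) / m" if "m \<noteq> 0" "m - 1 \<noteq> 0" for m c d
      using that by (simp add: divide_simps) (simp add: algebra_simps)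
    then show ?thesis using \<mu> by (metis right_minus_eq)
  qed
  also have "\<mu> - 1 = \<xi> + of_nat j - 1 / 2" by (simp add: \<mu>_eq)
  finally show ?thesis by (simp only: step_coeff_def)
qed

end

section \<open>The decomposition\<close>

text \<open>The situation of the theorem, with the homogeneity of the highest weight vector, which
  follows from \<open>highest_weight_homogeneous\<close>, recorded as an assumption.\<close>

locale polynomial_tensor_irrep = polynomial_tensor \<sigma> a b
  for \<sigma> :: "osp12 \<Rightarrow> 'v::super_vector \<Rightarrow> 'v" and a b :: complex +
  fixes l :: nat and v :: 'v and p :: bit
  assumes irrep: "highest_weight_irrep \<sigma> (- of_nat l) v"
    and dim: "cv.dim (UNIV :: 'v set) = 2 * l + 1"
    and hom_v: "homogeneous p v"
    and span_v: "Q.lowered_span v = UNIV"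
begin

lemma singular_v: "singular_vector \<sigma> (- of_nat l) v"
  using irrep by (simp add: highest_weight_irrep_def singular_vector_def)

lemma lowering_pow_v_eq_0_iff: "(\<sigma> x_ma ^^ k) v = 0 \<longleftrightarrow> 2 * l < k"
  using Q.lowering_pow_eq_0_iff[of v "- of_nat l" k] singular_v span_v dim
  by (auto simp: singular_vector_def)

text \<open>An eigenvector of \<open>H\<close> with integral eigenvalue would have a nonzero coefficient in \<open>V(-\<ell>)\<close> of
  half-integral weight, whereas all weights there are integral.\<close>

lemma inj_weight_shift: "inj (\<lambda>w. T x_h w - of_nat c *\<^sub>C w)"
proof (rule injI)
  fix s t assume "T x_h s - of_nat c *\<^sub>C s = T x_h t - of_nat c *\<^sub>C t"
  then have st: "T x_h (s - t) = of_nat c *\<^sub>C (s - t)"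
    by (simp add: T.L.diff cv.scale_right_diff_distrib algebra_simps)
  have "s - t = 0"
  proof (rule component_eqI, rule ccontr)
    fix n assume y: "component n (s - t) \<noteq> 0"
    let ?y = "component n (s - t)"
    have "(of_nat n + 1 / 2) *\<^sub>C ?y + \<sigma> x_h ?y = of_nat c *\<^sub>C ?y"
      using component_weight[of n "s - t"] by (simp only: st clinear_scale[OF clinear_component])
    then have "\<sigma> x_h ?y = (of_nat c - (of_nat n + 1 / 2)) *\<^sub>C ?y"
      by (simp only: cv.scale_left_diff_distrib eq_diff_eq add.commute)
    then obtain k where "of_nat c - (of_nat n + 1 / 2) = - of_nat l + (of_nat k :: complex)"
      using Q.weights_of_lowered_span[of v "- of_nat l" ?y] singular_v span_v y
      by (auto simp: singular_vector_def)
    then have "(1 / 2 :: complex) + of_int (int k) = of_int (int c + int l - int n)"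
      by (simp add: algebra_simps)
    then show False using half_plus_int_neq by blast
  qed
  then show "s = t" by simp
qed

definition hwv_weight :: "nat \<Rightarrow> complex"
  where "hwv_weight j = - of_nat l + of_nat j + 1 / 2"

lemma hwv_weight_neq_int: "hwv_weight j \<noteq> of_int k"
proof
  assume "hwv_weight j = of_int k"
  then have "(1 / 2 :: complex) + of_int (int j - int l) = of_int k"
    by (simp add: hwv_weight_def algebra_simps)
  then show False using half_plus_int_neq by blast
qed

text \<open>The only way for \<open>c\<^sub>k\<close> to vanish for \<open>k \<ge> 1\<close> is an integral weight.\<close>

lemma ladder_hwv_weight_neq_0: "ladder (hwv_weight j) (Suc k) \<noteq> 0"
proof (cases "odd (Suc k)")
  case True
  then have "ladder (hwv_weight j) (Suc k) = of_nat (Suc k div 2) + hwv_weight j" by (simp add: ladder_def)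
  moreover have "hwv_weight j \<noteq> - of_nat (Suc k div 2)"
    using hwv_weight_neq_int[of j "- int (Suc k div 2)"] by simp
  ultimately show ?thesis by (metis add.commute eq_neg_iff_add_eq_0)
next
  case False
  then have "Suc k div 2 \<noteq> 0" by auto
  then show ?thesis unfolding ladder_def if_not_P[OF False] add_0_right of_nat_eq_0_iff .
qed

definition hwv :: "nat \<Rightarrow> (complex poly, 'v) tensor"
  where "hwv j = (step_op (poly_rep a b) \<sigma> ^^ j) (1 \<otimes> v)"

lemma hwv_0:
  "singular_vector T (hwv_weight 0) (hwv 0)" "homogeneous p (hwv 0)" "component 0 (hwv 0) = v"
proof -
  have one: "homogeneous 0 (1 :: complex poly)"
    unfolding homogeneous_def
  proof (rule poly_eqI)
    show "coeff (hpart 0 1) n = coeff (1 :: complex poly) n" for n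
      by (cases n) (simp_all add: coeff_hpart)
  qed
  have act: "T x (1 \<otimes> v) = poly_rep a b x 1 \<otimes> v + 1 \<otimes> \<sigma> x v" if "osp_part q x = x" for q x
    by (simp add: tensor_rep_def act_left_prod[OF one] act_right_prod[OF one that] koszul_def scaleC_one)
  have pr: "poly_rep a b x_h 1 = (1 / 2) *\<^sub>C 1" "poly_rep a b x_a 1 = 0"
    using highest_weight_irrep_poly_rep[OF ab] by (simp_all add: highest_weight_irrep_def)
  have sv: "\<sigma> x_h v = (- of_nat l) *\<^sub>C v" "\<sigma> x_a v = 0"
    using singular_v by (auto simp: singular_vector_def)
  have "T x_h (hwv 0) = hwv_weight 0 *\<^sub>C hwv 0"
    unfolding hwv_def hwv_weight_def funpow.simps id_apply act[OF osp_part_basis(3)] pr sv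
      tensor_prod_scale_left tensor_prod_scale_right scaleC_add_left[symmetric]
    by (simp add: add.commute)
  moreover have "T x_a (hwv 0) = 0"
    by (simp add: hwv_def act[OF osp_part_basis(4)] pr sv)
  ultimately show "singular_vector T (hwv_weight 0) (hwv 0)" by (simp add: singular_vector_def)
  show "homogeneous p (hwv 0)"
    using hom_v hpart_tensor_homogeneous[OF one, of p v] unfolding homogeneous_def hwv_def
    by (cases p) simp_all
  show "component 0 (hwv 0) = v"
    by (simp add: hwv_def component_prod scaleC_one)
qed

lemma step_op_singular:
  assumes "singular_vector T (hwv_weight j) w"
  shows "step_op (poly_rep a b) \<sigma> w = step_vector (hwv_weight j) w"
  using assms hwv_weight_neq_int[of j 0] hwv_weight_neq_int[of j 1] inj_weight_shift[of 1] inj_weight_shift[of 2]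
  by (intro step_op_eq_step_vector) (simp_all add: singular_vector_def scaleC_one)

text \<open>Carried along together, since the evaluation of the step operator and of its leading
  coefficient both use that the current vector is singular.\<close>

lemma hwv_invariants:
  "singular_vector T (hwv_weight j) (hwv j) \<and> homogeneous (p + of_nat j) (hwv j)
    \<and> (\<exists>\<beta>. \<beta> \<noteq> 0 \<and> component 0 (hwv j) = \<beta> *\<^sub>C (\<sigma> x_ma ^^ j) v)"
proof (induction j)
  case 0
  have "component 0 (hwv 0) = 1 *\<^sub>C (\<sigma> x_ma ^^ 0) v" by (simp add: hwv_0 scaleC_one)
  moreover have "homogeneous (p + of_nat 0) (hwv 0)" using hwv_0(2) by (cases p) simp_all
  ultimately show ?case using hwv_0(1) one_neq_zero by blast
next
  case (Suc j)
  then obtain \<beta> where w: "singular_vector T (hwv_weight j) (hwv j)" and h: "homogeneous (p + of_nat j) (hwv j)"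
    and \<beta>: "\<beta> \<noteq> 0" "component 0 (hwv j) = \<beta> *\<^sub>C (\<sigma> x_ma ^^ j) v" by blast
  have ne: "hwv_weight j \<noteq> 0" "hwv_weight j \<noteq> 1" using hwv_weight_neq_int[of j 0] hwv_weight_neq_int[of j 1] by simp_all
  have eq: "hwv (Suc j) = step_vector (hwv_weight j) (hwv j)"
    using step_op_singular[OF w] by (simp add: hwv_def)
  have "hwv_weight j + 1 = hwv_weight (Suc j)" by (simp add: hwv_weight_def)
  then have "singular_vector T (hwv_weight (Suc j)) (hwv (Suc j))"
    using singular_step_vector[OF w ne] by (simp only: eq)
  moreover have "p + of_nat j + 1 = p + of_nat (Suc j)" by (simp add: add.assoc add.commute)
  then have "homogeneous (p + of_nat (Suc j)) (hwv (Suc j))"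
    using homogeneous_step_vector[OF h, of "hwv_weight j"] by (simp only: eq)
  moreover have "component 0 (hwv (Suc j))
      = (\<beta> * step_coeff (- of_nat l) j / hwv_weight j) *\<^sub>C (\<sigma> x_ma ^^ Suc j) v"
    unfolding eq by (rule component_0_step_vector[OF hwv_weight_def w singular_v \<beta>(2) ne])
  moreover have "\<beta> * step_coeff (- of_nat l) j / hwv_weight j \<noteq> 0"
    using \<beta>(1) ne step_coeff_neq_0 by simp
  ultimately show ?case by blast
qed

lemma singular_hwv: "singular_vector T (hwv_weight j) (hwv j)"
  and homogeneous_hwv: "homogeneous (p + of_nat j) (hwv j)"
  using hwv_invariants by blast+

lemma raise_hwv: "T x_a (hwv j) = 0"
  using singular_hwv by (simp add: singular_vector_def)

lemma component_0_hwv: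
  obtains \<beta> where "\<beta> \<noteq> 0" "component 0 (hwv j) = \<beta> *\<^sub>C (\<sigma> x_ma ^^ j) v"
  using hwv_invariants by blast

lemma hwv_neq_0:
  assumes "j \<le> 2 * l" shows "hwv j \<noteq> 0"
proof
  assume "hwv j = 0"
  then have "component 0 (hwv j) = 0"
    using clinear_scale[OF clinear_component, of 0 0 0] by simp
  moreover obtain \<beta> where "\<beta> \<noteq> 0" "component 0 (hwv j) = \<beta> *\<^sub>C (\<sigma> x_ma ^^ j) v"
    by (rule component_0_hwv)
  ultimately show False using lowering_pow_v_eq_0_iff[of j] assms by simp
qed

text \<open>Their coefficients of \<open>x\<^sup>0\<close> are nonzero vectors of distinct weights.\<close>

lemma hwv_independent:
  assumes "(\<Sum>j\<le>2 * l. c j *\<^sub>C hwv j) = 0" and "j \<le> 2 * l"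
  shows "c j = 0"
proof -
  interpret C: Vector_Spaces.linear scaleC scaleC "component 0 :: (complex poly, 'v) tensor \<Rightarrow> 'v"
    by (rule clinear_component)
  have "\<forall>j. \<exists>\<beta>. \<beta> \<noteq> 0 \<and> component 0 (hwv j) = \<beta> *\<^sub>C (\<sigma> x_ma ^^ j) v"
    using hwv_invariants by blast
  then obtain \<beta> where \<beta>: "\<And>j. \<beta> j \<noteq> 0" "\<And>j. component 0 (hwv j) = \<beta> j *\<^sub>C (\<sigma> x_ma ^^ j) v"
    by metis
  have "(c j * \<beta> j) *\<^sub>C (\<sigma> x_ma ^^ j) v = 0"
  proof (rule eigenvector_sum_eq_0[where T = "\<sigma> x_h" and S = "{..2 * l}" and k = j
        and y = "\<lambda>j. (c j * \<beta> j) *\<^sub>C (\<sigma> x_ma ^^ j) v" and \<mu> = "\<lambda>j. - of_nat l + of_nat j"])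
    have "component 0 (\<Sum>j\<le>2 * l. c j *\<^sub>C hwv j) = 0"
      using assms(1) C.zero by simp
    then show "(\<Sum>j\<le>2 * l. (c j * \<beta> j) *\<^sub>C (\<sigma> x_ma ^^ j) v) = 0"
      by (simp only: C.sum C.scale \<beta>(2) scaleC_scaleC)
    show "\<sigma> x_h ((c k * \<beta> k) *\<^sub>C (\<sigma> x_ma ^^ k) v)
        = (- of_nat l + of_nat k) *\<^sub>C (c k * \<beta> k) *\<^sub>C (\<sigma> x_ma ^^ k) v" for k
      using Q.weight_lowering_pow[of v "- of_nat l" k] singular_v
      by (simp only: Q.L.scale singular_vector_def scaleC_scaleC mult.commute)
  qed (use assms(2) in \<open>auto simp: inj_on_def Q.clinear_rep\<close>)
  then show ?thesis using \<beta>(1) lowering_pow_v_eq_0_iff[of j] assms(2) by simp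
qed

text \<open>The coefficients of \<open>x\<^sup>0\<close> of the generators already span \<open>V(-\<ell>)\<close>, and an element of the kernel is
  determined by that coefficient.\<close>

lemma kernel_raise:
  assumes t: "T x_a t = 0"
  shows "t \<in> cv.span (hwv ` {..2 * l})"
proof -
  interpret C: Vector_Spaces.linear scaleC scaleC "component 0 :: (complex poly, 'v) tensor \<Rightarrow> 'v"
    by (rule clinear_component)
  let ?S = "cv.span (hwv ` {..2 * l})"
  have sub: "cv.subspace (component 0 ` ?S)"
    by (rule C.subspace_image) simp
  have "(\<sigma> x_ma ^^ k) v \<in> component 0 ` ?S" for k
  proof (cases "k \<le> 2 * l")
    case True
    obtain \<beta> where \<beta>: "\<beta> \<noteq> 0" "component 0 (hwv k) = \<beta> *\<^sub>C (\<sigma> x_ma ^^ k) v"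
      by (rule component_0_hwv)
    have "hwv k \<in> ?S" using True by (intro cv.span_base) auto
    then have "\<beta> *\<^sub>C (\<sigma> x_ma ^^ k) v \<in> component 0 ` ?S" using \<beta>(2) by (metis imageI)
    then have "inverse \<beta> *\<^sub>C \<beta> *\<^sub>C (\<sigma> x_ma ^^ k) v \<in> component 0 ` ?S"
      by (rule cv.subspace_scale[OF sub])
    then show ?thesis using \<beta>(1) by (simp add: scaleC_scaleC scaleC_one)
  next
    case False
    then show ?thesis using lowering_pow_v_eq_0_iff[of k] cv.subspace_0[OF sub] by simp
  qed
  then have "Q.lowered_span v \<subseteq> component 0 ` ?S"
    unfolding Q.lowered_span_def by (intro cv.span_minimal sub) auto
  then have "component 0 t \<in> component 0 ` ?S"
    unfolding span_v by (rule subsetD) (rule UNIV_I)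
  then obtain s where s: "s \<in> ?S" "component 0 s = component 0 t" by auto
  have "T x_a s \<in> cv.span {0}"
    by (rule clinear_span_closed[OF T.clinear_rep _ s(1)]) (auto simp: raise_hwv cv.span_zero)
  then have "T x_a (t - s) = 0" using t by (simp add: T.L.diff)
  moreover have "component 0 (t - s) = 0" by (simp add: C.diff s(2))
  ultimately have "t - s = 0" by (rule kernel_component_0)
  with s(1) show ?thesis by simp
qed

text \<open>Since the ladder scalars are nonzero, \<open>f\<^sup>k w\<close> is the image of a multiple of \<open>f\<^bsup>k+1\<^esup> w\<close>.\<close>

lemma raise_onto:
  assumes "s \<in> T.lowered_span (hwv j)"
  obtains t where "t \<in> T.lowered_span (hwv j)" "T x_a t = s"
proof -
  have sub: "cv.subspace (T x_a ` T.lowered_span (hwv j))"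
    by (rule T.L.subspace_image) (rule T.subspace_lowered_span)
  have "(T x_ma ^^ k) (hwv j) \<in> T x_a ` T.lowered_span (hwv j)" for k
  proof -
    let ?c = "ladder (hwv_weight j) (Suc k)"
    have "T x_a (inverse ?c *\<^sub>C (T x_ma ^^ Suc k) (hwv j)) = (T x_ma ^^ k) (hwv j)"
      unfolding T.L.scale T.raising_lowering_pow[OF singular_hwv]
      using ladder_hwv_weight_neq_0[of j k] by (simp add: scaleC_scaleC scaleC_one)
    then show ?thesis
      using cv.subspace_scale[OF T.subspace_lowered_span T.lowering_pow_in] by (metis imageI)
  qed
  then have "T.lowered_span (hwv j) \<subseteq> T x_a ` T.lowered_span (hwv j)"
    unfolding T.lowered_span_def[of "hwv j"] using sub[unfolded T.lowered_span_def]
    by (intro cv.span_minimal) auto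
  with assms that show thesis by blast
qed

lemma raise_onto_sum:
  assumes "s \<in> cv.span (\<Union>j\<le>2 * l. T.lowered_span (hwv j))" (is "s \<in> ?M")
  obtains t where "t \<in> ?M" "T x_a t = s"
proof -
  have sub: "cv.subspace (T x_a ` ?M)"
    by (rule T.L.subspace_image) simp
  have "T.lowered_span (hwv j) \<subseteq> T x_a ` ?M" if "j \<le> 2 * l" for j
  proof
    fix s assume "s \<in> T.lowered_span (hwv j)"
    then obtain t where "t \<in> T.lowered_span (hwv j)" "T x_a t = s" by (rule raise_onto)
    moreover from this(1) have "t \<in> ?M" using that by (intro cv.span_base) auto
    ultimately show "s \<in> T x_a ` ?M" by blast
  qed
  then have "?M \<subseteq> T x_a ` ?M" by (intro cv.span_minimal sub) auto
  with assms that show thesis by blast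
qed

text \<open>By induction \<open>e t\<close> lies in the sum, and has a preimage \<open>s\<close> there; the difference \<open>t - s\<close> is in
  the kernel of \<open>e\<close>, which is spanned by the generators.  The condition on the coefficients measures
  total degree: raising lowers either the exponent of \<open>x\<close> or the height in the second factor, so it
  passes from \<open>r + 1\<close> for \<open>t\<close> to \<open>r\<close> for \<open>e t\<close>.\<close>

lemma in_sum_if_nilpotent:
  assumes "\<And>n i. r \<le> n + i \<Longrightarrow> (\<sigma> x_a ^^ i) (component n t) = 0"
  shows "t \<in> cv.span (\<Union>j\<le>2 * l. T.lowered_span (hwv j))"
  using assms
proof (induction r arbitrary: t)
  case 0
  have "t = 0" by (rule component_eqI) (use "0"[of _ 0] in simp)
  then show ?case by (simp add: cv.span_zero)
next
  case (Suc r)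
  let ?M = "cv.span (\<Union>j\<le>2 * l. T.lowered_span (hwv j))"
  have "T x_a t \<in> ?M"
  proof (rule Suc.IH)
    fix n i assume "r \<le> n + i"
    then have "(\<sigma> x_a ^^ i) (component (Suc n) t) = 0" "(\<sigma> x_a ^^ Suc i) (component n t) = 0"
      using Suc.prems[of "Suc n" i] Suc.prems[of n "Suc i"] by simp_all
    then show "(\<sigma> x_a ^^ i) (component n (T x_a t)) = 0"
      unfolding component_raise Q.raising_pow_add Q.raising_pow_scale funpow_Suc_right o_apply
      by simp
  qed
  then obtain s where s: "s \<in> ?M" "T x_a s = T x_a t" by (rule raise_onto_sum)
  have "T x_a (t - s) = 0" by (simp add: T.L.diff s(2))
  then have "t - s \<in> cv.span (hwv ` {..2 * l})" by (rule kernel_raise)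
  moreover have "hwv ` {..2 * l} \<subseteq> (\<Union>j\<le>2 * l. T.lowered_span (hwv j))"
    using T.self_in_lowered_span by blast
  ultimately have "t - s \<in> ?M" using cv.span_mono by blast
  from cv.span_add[OF this s(1)] show ?case by simp
qed

text \<open>Only finitely many coefficients of \<open>t\<close> are nonzero and each is killed by a power of \<open>x\<^sub>\<alpha>\<close>, so
  \<open>in_sum_if_nilpotent\<close> applies with a large enough bound.\<close>

lemma span_lowered_hwv: "cv.span (\<Union>j\<le>2 * l. T.lowered_span (hwv j)) = UNIV"
proof (intro set_eqI iffI UNIV_I)
  fix t :: "(complex poly, 'v) tensor"
  obtain N where N: "\<And>n. N \<le> n \<Longrightarrow> component n t = 0"
    using component_eventually_0[of t] by blast
  have "\<forall>n. \<exists>m. (\<sigma> x_a ^^ m) (component n t) = 0"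
  proof
    fix n
    have "component n t \<in> Q.lowered_span v" unfolding span_v by (rule UNIV_I)
    then show "\<exists>m. (\<sigma> x_a ^^ m) (component n t) = 0"
      using Q.raising_nilpotent[OF singular_v] by blast
  qed
  then obtain m where m: "\<And>n. (\<sigma> x_a ^^ m n) (component n t) = 0" by metis
  show "t \<in> cv.span (\<Union>j\<le>2 * l. T.lowered_span (hwv j))"
  proof (rule in_sum_if_nilpotent)
    fix n i assume i: "N + (\<Sum>n<N. m n) \<le> n + i"
    show "(\<sigma> x_a ^^ i) (component n t) = 0"
    proof (cases "n < N")
      case True
      then have "m n \<le> (\<Sum>n<N. m n)" by (intro member_le_sum) auto
      with i True have "m n \<le> i" by linarith
      then obtain k where "i = k + m n" by (metis le_add_diff_inverse2)
      then show ?thesis by (simp add: funpow_add m)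
    qed (simp add: N)
  qed
qed

text \<open>Raising preserves the relation, so by induction all \<open>e u\<^sub>j\<close> vanish.  Then each \<open>u\<^sub>j\<close> is a multiple of
  the generator \<open>w\<^sub>j\<close>, and these are independent.\<close>

lemma sum_eq_0_if_nilpotent:
  assumes "\<And>j. j \<le> 2 * l \<Longrightarrow> u j \<in> T.lowered_span (hwv j)"
    and "\<And>j. j \<le> 2 * l \<Longrightarrow> (T x_a ^^ r) (u j) = 0"
    and "(\<Sum>j\<le>2 * l. u j) = 0" and "j \<le> 2 * l"
  shows "u j = 0"
  using assms
proof (induction r arbitrary: u j)
  case (Suc r)
  have closed: "T x_a (u j) \<in> T.lowered_span (hwv j)" if "j \<le> 2 * l" for j
    using T.subrep_lowered_span[OF singular_hwv homogeneous_hwv] Suc.prems(1)[OF that]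
    by (simp add: subrep_def)
  have nilp: "(T x_a ^^ r) (T x_a (u j)) = 0" if "j \<le> 2 * l" for j
    using Suc.prems(2)[OF that] unfolding funpow_Suc_right o_apply .
  have "T x_a (\<Sum>j\<le>2 * l. u j) = 0" by (simp only: Suc.prems(3) T.L.zero)
  then have sum: "(\<Sum>j\<le>2 * l. T x_a (u j)) = 0" by (simp only: T.L.sum)
  have ker: "T x_a (u j) = 0" if "j \<le> 2 * l" for j
    by (rule Suc.IH[OF closed nilp sum that])
  have "\<exists>c. u j = c *\<^sub>C hwv j" if "j \<le> 2 * l" for j
    using T.lowered_span_kernel[OF singular_hwv ladder_hwv_weight_neq_0 Suc.prems(1)[OF that] ker[OF that]]
    by blast
  then obtain c where c: "\<And>j. j \<le> 2 * l \<Longrightarrow> u j = c j *\<^sub>C hwv j" by metis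
  have "(\<Sum>j\<le>2 * l. c j *\<^sub>C hwv j) = (\<Sum>j\<le>2 * l. u j)"
    by (intro sum.cong) (simp_all add: c)
  then have "c j = 0"
    using Suc.prems(3) by (intro hwv_independent[OF _ Suc.prems(4)]) simp
  then show ?case using c[OF Suc.prems(4)] by simp
qed simp

lemma direct_sum_lowered_hwv: "is_direct_sum {0..2 * l} (\<lambda>j. T.lowered_span (hwv j))"
proof (rule is_direct_sumI)
  show "cv.span (\<Union>j\<in>{0..2 * l}. T.lowered_span (hwv j)) = UNIV"
    using span_lowered_hwv by (simp add: atMost_atLeast0)
  fix u assume u: "\<And>j. j \<in> {0..2 * l} \<Longrightarrow> u j \<in> T.lowered_span (hwv j)"
    and sum: "(\<Sum>j\<in>{0..2 * l}. u j) = 0"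
  have "\<exists>m. (T x_a ^^ m) (u j) = 0" if "j \<le> 2 * l" for j
    using T.raising_nilpotent[OF singular_hwv u[of j]] that by auto
  then obtain m where m: "\<And>j. j \<le> 2 * l \<Longrightarrow> (T x_a ^^ m j) (u j) = 0" by metis
  have "(T x_a ^^ (\<Sum>j\<le>2 * l. m j)) (u j) = 0" if "j \<le> 2 * l" for j
  proof -
    have "m j \<le> (\<Sum>j\<le>2 * l. m j)" using that by (intro member_le_sum) auto
    then obtain k where "(\<Sum>j\<le>2 * l. m j) = k + m j" by (metis le_add_diff_inverse2)
    then show ?thesis by (simp add: funpow_add m[OF that])
  qed
  note nilpotent = this
  show "\<forall>j\<in>{0..2 * l}. u j = 0"
  proof
    fix j assume "j \<in> {0..2 * l}"
    then have j: "j \<le> 2 * l" by simp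
    have mem: "u i \<in> T.lowered_span (hwv i)" if "i \<le> 2 * l" for i
      using that by (intro u) simp
    have sum0: "(\<Sum>j\<le>2 * l. u j) = 0" using sum by (simp only: atMost_atLeast0)
    show "u j = 0" by (rule sum_eq_0_if_nilpotent[OF mem nilpotent sum0 j])
  qed
qed (auto simp: T.subspace_lowered_span)

lemma irreducible_lowered_hwv:
  assumes "j \<le> 2 * l" shows "irreducible_subrep T (T.lowered_span (hwv j))"
  by (rule T.irreducible_lowered_span[OF singular_hwv homogeneous_hwv hwv_neq_0[OF assms] ladder_hwv_weight_neq_0])

end

theorem theorem1p3:
  fixes l :: nat
    and a b :: complex
    and \<rho> :: "osp12 \<Rightarrow> 'v::super_vector \<Rightarrow> 'v"
    and v\<^sub>l :: 'v
  assumes "a * b = 1 / 2"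
    and "highest_weight_irrep \<rho> (- of_nat l) v\<^sub>l"
    and "cv.dim (UNIV :: 'v set) = 2 * l + 1"
  shows "let T = tensor_rep (poly_rep a b) \<rho>;
             W = (\<lambda>j. U_submodule T n_minus ((step_op (poly_rep a b) \<rho> ^^ j) (1 \<otimes> v\<^sub>l)))
         in (\<forall>j\<in>{0..2 * l}. irreducible_subrep T (W j)) \<and> is_direct_sum {0..2 * l} W"
proof -
  interpret Q: osp_rep \<rho>
    using assms(2)
    by unfold_locales (simp add: highest_weight_irrep_def irreducible_subrep_def subrep_def)
  obtain p where "homogeneous p v\<^sub>l" "Q.lowered_span v\<^sub>l = UNIV"
    by (rule Q.highest_weight_homogeneous[OF assms(2)])
  then interpret polynomial_tensor_irrep \<rho> a b l v\<^sub>l p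
    by unfold_locales (rule assms | assumption)+
  show ?thesis
    using irreducible_lowered_hwv direct_sum_lowered_hwv
    by (simp add: T.U_submodule_n_minus hwv_def[symmetric])
qed

end
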